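(* Let $\mathbb{F}_q$ be a finite field, let $d$ and $k$ be positive integers with $k>d$, let $f=T^{k+d}+f_{d-1}T^{k+d-1}+\cdots+f_1T^{k+1}+f_0T^k\in\mathbb{F}_q[T]$, and let $V_f\subset\mathbb{A}^{k+1}$ be the hypersurface defined by the polynomial $H_f\in\mathbb{F}_q[X_1,\ldots,X_{k+1}]$ associated to $f$. If the singular locus $\Sigma_f$ of $V_f$ has dimension $d-1$, then $f_0=\cdots=f_{d-1}=0$.
   Context: $\mathbb{A}^{n}$ denotes affine $n$-space over the algebraic closure $\overline{\mathbb{F}}_q$. Given $f=T^{k+d}+f_{d-1}T^{k+d-1}+\cdots+f_0T^k\in\mathbb{F}_q[T]$, put $Q=(T-X_1)\cdots(T-X_{k+1})\in\mathbb{F}_q[X_1,\ldots,X_{k+1}][T]$ and let $R_f\in\mathbb{F}_q[X_1,\ldots,X_{k+1}][T]$ be the unique polynomial of degree at most $k$ in $T$ with $f\equiv R_f \bmod Q$. The polynomial $H_f\in\mathbb{F}_q[X_1,\ldots,X_{k+1}]$ associated to $f$ is the coefficient of $T^k$ in $R_f$. $V_f\subset\mathbb{A}^{k+1}$ is the set of zeros of $H_f$ in $\mathbb{A}^{k+1}$. For an affine variety $V\subset\mathbb{A}^n$ with defining ideal $I(V)=(F_1,\ldots,F_m)\subset\overline{\mathbb{F}}_q[X_1,\ldots,X_n]$ and $\mathbf{x}\in V$, the tangent space $\mathcal{T}_{\mathbf{x}}V$ is the kernel of the Jacobian matrix $(\partial F_i/\partial X_j)(\mathbf{x})$, and $\dim_{\mathbf{x}}V$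 is the maximum of the dimensions of the irreducible components of $V$ containing $\mathbf{x}$. The point $\mathbf{x}$ is singular if $\dim\mathcal{T}_{\mathbf{x}}V\neq\dim_{\mathbf{x}}V$; the singular locus of $V$ is the set of its singular points. The empty set has negative dimension. *)

theory Defs
  imports
    "HOL-Library.Poly_Mapping"
    "HOL-Library.Extended_Real"
    "HOL-Computational_Algebra.Polynomial"
    "HOL-Computational_Algebra.Primes"
    "HOL-Algebra.Algebraic_Closure_Type"
    "Jordan_Normal_Form.Matrix_Kernel"
begin

section \<open>Multivariate polynomials\<close>

text \<open>A polynomial is a finitely supported map from exponent vectors to coefficients. Variables
  are numbered from \<open>0\<close>: the variable \<open>X\<^sub>i\<^sub>+\<^sub>1\<close> of the usual notation has index \<open>i\<close>, and
  \<open>mpolys n\<close> is the ring of polynomials in the first \<open>n\<close> variables. Points of affine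
  \<open>n\<close>-space are the vectors in \<open>carrier_vec n\<close>.\<close>

type_synonym 'a mpoly = "(nat \<Rightarrow>\<^sub>0 nat) \<Rightarrow>\<^sub>0 'a"

definition mpolys :: "nat \<Rightarrow> 'a::comm_ring_1 mpoly set" where
  "mpolys n = {p. \<forall>m \<in> Poly_Mapping.keys p. Poly_Mapping.keys m \<subseteq> {..<n}}"

definition mpoly_const :: "'a::comm_ring_1 \<Rightarrow> 'a mpoly" where
  "mpoly_const c = Poly_Mapping.single 0 c"

definition mpoly_var :: "nat \<Rightarrow> 'a::comm_ring_1 mpoly" where
  "mpoly_var i = Poly_Mapping.single (Poly_Mapping.single i 1) 1"

definition mpoly_eval :: "'a::comm_ring_1 mpoly \<Rightarrow> 'a vec \<Rightarrow> 'a" where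
  "mpoly_eval p x = (\<Sum>m \<in> Poly_Mapping.keys p.
     Poly_Mapping.lookup p m *
       (\<Prod>i \<in> Poly_Mapping.keys m. (x $ i) ^ Poly_Mapping.lookup m i))"

text \<open>The truncated subtraction \<open>m - single j 1\<close> is harmless: if \<open>j\<close> does not occur in \<open>m\<close>,
  then the coefficient of that summand is zero.\<close>

definition mpoly_pderiv :: "nat \<Rightarrow> 'a::comm_ring_1 mpoly \<Rightarrow> 'a mpoly" where
  "mpoly_pderiv j p = (\<Sum>m \<in> Poly_Mapping.keys p.
     Poly_Mapping.single (m - Poly_Mapping.single j 1)
       (of_nat (Poly_Mapping.lookup m j) * Poly_Mapping.lookup p m))"


section \<open>Affine varieties\<close>

definition zero_set :: "nat \<Rightarrow> 'k::field mpoly set \<Rightarrow> 'k vec set" where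
  "zero_set n S = {x \<in> carrier_vec n. \<forall>p \<in> S. mpoly_eval p x = 0}"

definition algebraic_set :: "nat \<Rightarrow> 'k::field vec set \<Rightarrow> bool" where
  "algebraic_set n V \<longleftrightarrow> (\<exists>S \<subseteq> mpolys n. V = zero_set n S)"

definition vanishing_ideal :: "nat \<Rightarrow> 'k::field vec set \<Rightarrow> 'k mpoly set" where
  "vanishing_ideal n V = {p \<in> mpolys n. \<forall>x \<in> V. mpoly_eval p x = 0}"

definition ideal_generated :: "nat \<Rightarrow> 'k::field mpoly list \<Rightarrow> 'k mpoly set" where
  "ideal_generated n Fs = {\<Sum>i<length Fs. G i * Fs ! i | G. \<forall>i. G i \<in> mpolys n}"

definition irreducible_variety :: "nat \<Rightarrow> 'k::field vec set \<Rightarrow> bool" where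
  "irreducible_variety n W \<longleftrightarrow> algebraic_set n W \<and> W \<noteq> {} \<and>
     (\<forall>A B. algebraic_set n A \<longrightarrow> algebraic_set n B \<longrightarrow> W = A \<union> B \<longrightarrow> W = A \<or> W = B)"

definition irreducible_component :: "nat \<Rightarrow> 'k::field vec set \<Rightarrow> 'k vec set \<Rightarrow> bool" where
  "irreducible_component n V W \<longleftrightarrow> irreducible_variety n W \<and> W \<subseteq> V \<and>
     (\<forall>W'. irreducible_variety n W' \<longrightarrow> W \<subseteq> W' \<longrightarrow> W' \<subseteq> V \<longrightarrow> W' = W)"

text \<open>The dimension is the supremum of the lengths \<open>r\<close> of chains \<open>C\<^sub>0 \<subset> \<dots> \<subset> C\<^sub>r\<close> of irreducible
  varieties contained in \<open>V\<close>. The empty set has dimension \<open>Sup {} = - \<infinity>\<close>.\<close>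

definition variety_dim :: "nat \<Rightarrow> 'k::field vec set \<Rightarrow> ereal" where
  "variety_dim n V =
     (SUP r \<in> {r. \<exists>C :: nat \<Rightarrow> 'k vec set.
                   (\<forall>i\<le>r. irreducible_variety n (C i) \<and> C i \<subseteq> V) \<and> (\<forall>i<r. C i \<subset> C (Suc i))}.
        ereal (real r))"

definition local_dim :: "nat \<Rightarrow> 'k::field vec set \<Rightarrow> 'k vec \<Rightarrow> ereal" where
  "local_dim n V x = (SUP W \<in> {W. irreducible_component n V W \<and> x \<in> W}. variety_dim n W)"

definition jacobian :: "nat \<Rightarrow> 'k::field mpoly list \<Rightarrow> 'k vec \<Rightarrow> 'k mat" where
  "jacobian n Fs x = mat (length Fs) n (\<lambda>(i, j). mpoly_eval (mpoly_pderiv j (Fs ! i)) x)"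

text \<open>The tangent space at \<open>x\<close> is the kernel of the Jacobian matrix of a finite generating family
  of the ideal of \<open>V\<close>. Such a family exists by Hilbert's basis theorem, and the kernel does not
  depend on its choice, so the existential quantifier could equally well be a universal one.\<close>

definition singular_point :: "nat \<Rightarrow> 'k::field vec set \<Rightarrow> 'k vec \<Rightarrow> bool" where
  "singular_point n V x \<longleftrightarrow> x \<in> V \<and>
     (\<exists>Fs. ideal_generated n Fs = vanishing_ideal n V \<and>
           ereal (real (kernel_dim (jacobian n Fs x))) \<noteq> local_dim n V x)"

definition singular_locus :: "nat \<Rightarrow> 'k::field vec set \<Rightarrow> 'k vec set" where
  "singular_locus n V = {x. singular_point n V x}"


section \<open>The hypersurface associated to a polynomial\<close>

text \<open>\<open>Q = (T - X\<^sub>1) \<cdots> (T - X\<^sub>k\<^sub>+\<^sub>1)\<close> as a polynomial in \<open>T\<close>.\<close>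

definition Q_poly :: "nat \<Rightarrow> 'a::field mpoly poly" where
  "Q_poly k = (\<Prod>i<k+1. [:- mpoly_var i, 1:])"

definition R_poly :: "nat \<Rightarrow> 'a::field poly \<Rightarrow> 'a mpoly poly" where
  "R_poly k f = (THE R. degree R \<le> k \<and> Q_poly k dvd (map_poly mpoly_const f - R))"

definition H_poly :: "nat \<Rightarrow> 'a::field poly \<Rightarrow> 'a mpoly" where
  "H_poly k f = coeff (R_poly k f) k"

definition V_hyp :: "nat \<Rightarrow> 'a::field poly \<Rightarrow> 'a alg_closure vec set" where
  "V_hyp k f = zero_set (k + 1) {Poly_Mapping.map to_ac (H_poly k f)}"

lemma Q_poly_monic: "degree (Q_poly k :: 'a::field mpoly poly) = k + 1"
                    "lead_coeff (Q_poly k :: 'a::field mpoly poly) = 1"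
proof -
  have *: "degree (\<Prod>i<n. [:- mpoly_var i, 1 :: 'a mpoly:]) = n \<and>
           lead_coeff (\<Prod>i<n. [:- mpoly_var i, 1 :: 'a mpoly:]) = 1" for n
  proof (induction n)
    case (Suc n)
    let ?P = "\<Prod>i<n. [:- mpoly_var i, 1 :: 'a mpoly:]" and ?l = "[:- mpoly_var n, 1 :: 'a mpoly:]"
    have "?P \<noteq> 0" using Suc by auto
    then have "degree (?P * ?l) = Suc n" using Suc by (subst degree_mult_eq) auto
    moreover have "lead_coeff (?P * ?l) = 1" using Suc by (subst lead_coeff_mult) auto
    ultimately show ?case by (metis prod.lessThan_Suc)
  qed simp
  show "degree (Q_poly k :: 'a mpoly poly) = k + 1"
       "lead_coeff (Q_poly k :: 'a mpoly poly) = 1"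
    using *[of "k + 1"] unfolding Q_poly_def by blast+
qed

lemma R_poly_ex1:
  fixes f :: "'a::field poly"
  shows "\<exists>!R. degree R \<le> k \<and> Q_poly k dvd (map_poly mpoly_const f - R)"
proof (rule ex_ex1I)
  let ?Q = "Q_poly k :: 'a mpoly poly" and ?f = "map_poly mpoly_const f"
  have Q0: "?Q \<noteq> 0" using Q_poly_monic(1)[where ?'a = 'a, of k] by auto
  obtain q r where qr: "pseudo_divmod ?f ?Q = (q, r)" by (cases "pseudo_divmod ?f ?Q")
  from pseudo_divmod[OF Q0 qr] Q_poly_monic[where ?'a = 'a, of k]
  have "?f = ?Q * q + r" "r = 0 \<or> degree r < k + 1" by auto
  then show "\<exists>R. degree R \<le> k \<and> ?Q dvd (?f - R)"
    by (intro exI[of _ r]) auto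
next
  let ?Q = "Q_poly k :: 'a mpoly poly" and ?f = "map_poly mpoly_const f"
  fix R S
  assume R: "degree R \<le> k \<and> ?Q dvd (?f - R)" and S: "degree S \<le> k \<and> ?Q dvd (?f - S)"
  then have "?Q dvd (?f - S) - (?f - R)" using dvd_diff by blast
  then have "?Q dvd R - S" by simp
  moreover have "degree (R - S) \<le> k" using R S by (simp add: degree_diff_le)
  ultimately show "R = S"
    using Q_poly_monic(1)[where ?'a = 'a, of k] dvd_imp_degree_le[of ?Q "R - S"] by force
qed

end

theory Submission
  imports Defs "Jordan_Normal_Form.Char_Poly"
begin

text \<open>
  Let \<open>K\<close> be the algebraic closure, \<open>n = k + 1\<close>, and for a point \<open>x\<close> let \<open>N\<^sub>x\<close> be the product of the
  \<open>T - x\<^sub>i\<close>. Specialising \<open>R\<^sub>f\<close> at \<open>x\<close> gives the remainder of \<open>f\<close> by \<open>N\<^sub>x\<close>, so \<open>H\<^sub>f(x)\<close> is the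
  coefficient of \<open>T\<^sup>k\<close> in \<open>f mod N\<^sub>x\<close>. As a function of the single coordinate \<open>x\<^sub>i\<close> this is a monic
  polynomial of degree \<open>d\<close>, and its derivative is the value at \<open>x\<^sub>i\<close> of the quotient
  \<open>q = f div N\<^sub>x\<close> (\<open>fun_eval_H_ac\<close>, \<open>divide_by_one_more_node\<close>, \<open>pderiv_H_ac\<close>). At a singular point
  all partial derivatives of \<open>H\<^sub>f\<close> vanish, so every coordinate of the point is a root of \<open>q\<close>. Since
  \<open>q\<close> is monic of degree \<open>d - 1\<close>, a singular point has at most \<open>d - 1\<close> distinct coordinates.

  Suppose now that the singular locus has dimension \<open>d - 1\<close>, and let \<open>W\<close> be an irreducible variety
  in it that ends a chain of length at least \<open>d - 1\<close>. Let \<open>L\<close> be the linear space of the points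
  that satisfy all the equations \<open>X\<^sub>i = X\<^sub>j\<close> valid on \<open>W\<close>. Its dimension is the number of distinct coordinates of a
  general point of \<open>W\<close>, hence at most \<open>d - 1\<close>, and the chain leaves no room between \<open>W\<close> and \<open>L\<close>:
  \<open>W = L\<close>. Therefore the singular locus contains, with a point \<open>x\<close> that has exactly \<open>d - 1\<close> distinct
  coordinates, all its multiples \<open>t x\<close> (\<open>variety_of_few_distinct_coordinates\<close>). At \<open>t x\<close> with
  \<open>t \<noteq> 0\<close> the quotient is the product of the \<open>T - t a\<close> over the distinct coordinates \<open>a\<close> of \<open>x\<close>, and
  \<open>f\<close> agrees with \<open>N\<^bsub>t x\<^esub> q\<close> in all degrees from \<open>k\<close> on. So the coefficient \<open>f\<^sub>j\<close> is the value at every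
  \<open>t \<noteq> 0\<close> of a polynomial in \<open>t\<close>, and at \<open>t = 0\<close> that polynomial is a coefficient of \<open>T\<^bsup>k+d\<^esup>\<close> of
  degree below \<open>k + d\<close>: it is zero (\<open>coeffs_zero_if_all_scalings_singular\<close>).

  Two facts of algebraic geometry carry this argument. The first bounds the length of a chain of
  irreducible sets in a linear space by its dimension (\<open>chain_length_le\<close>): functions that separate
  the members of a chain are algebraically independent, whereas \<open>m + 1\<close> polynomials in \<open>m\<close>
  variables are dependent by a count of monomials.

  The second is the Jacobian criterion for a hypersurface \<open>H = 0\<close>, with \<open>H\<close> monic in one
  variable \<open>X\<^sub>i\<close>: a zero of \<open>H\<close> with nonzero \<open>i\<close>-th partial derivative is not singular
  (\<open>singular_point_hypersurface\<close>). Monicity replaces the Nullstellensatz. If \<open>F\<close> vanishes wherever \<open>H\<close> does, then over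
  each point of the base \<open>H\<close> specialises to a univariate polynomial all of whose roots are roots of
  \<open>F\<close>, so the remainder of \<open>F\<^sup>d\<close> by \<open>H\<close> vanishes over each point and \<open>H\<close> divides \<open>F\<^sup>d\<close>.
  Restricting this identity to a curve that lies on the hypersurface to high order shows that
  the gradients of \<open>F\<close> and \<open>H\<close> are proportional, so that the tangent space has dimension
  \<open>n - 1\<close>. The local dimension is \<open>n - 1\<close> as well: freeing the coordinates of the base one at a time,
  one extends \<open>{x}\<close> to a chain of irreducible varieties on the hypersurface
  (\<open>chain_through_point\<close>), because no function on the base divides zero modulo a monic \<open>H\<close>.
\<close>

section \<open>Substitution into multivariate polynomials\<close>

no_notation fps_nth (infixl "$" 75)


lemma infinite_UNIV_alg_closed: "infinite (UNIV :: 'a::alg_closed_field set)"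
proof
  assume fin: "finite (UNIV :: 'a set)"
  \<comment> \<open>over a finite field the value of this polynomial plus \<open>1\<close> is always \<open>1\<close>\<close>
  let ?p = "(\<Prod>a\<in>UNIV. [:-a, 1:]) :: 'a poly"
  have "degree ?p = card (UNIV :: 'a set)"
    by (subst degree_prod_eq_sum_degree) auto
  then have "degree ?p > 0" using fin by (simp add: card_gt_0_iff)
  then have "degree (?p + 1) > 0" by (subst degree_add_eq_left) auto
  then obtain r where r: "poly (?p + 1) r = 0" using alg_closed_imp_poly_has_root by blast
  have "poly ?p r = 0" using fin by (auto simp: poly_prod intro!: prod_zero bexI[of _ r])
  with r show False by simp
qed

lemma mpoly_induct [case_names zero single add]:
  fixes p :: "'a::comm_ring_1 mpoly"
  assumes "P 0" "\<And>m a. P (Poly_Mapping.single m a)" "\<And>p q. P p \<Longrightarrow> P q \<Longrightarrow> P (p + q)"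
  shows "P p"
proof (induction p rule: update_induct)
  case const
  show ?case by (rule assms(1))
next
  case (update p m a)
  have "Poly_Mapping.update m a p = p + Poly_Mapping.single m a"
    by (rule poly_mapping_eqI)
       (use update in \<open>auto simp: lookup_update lookup_add lookup_single when_def in_keys_iff\<close>)
  then show ?case using assms update by metis
qed

definition monom_eval :: "(nat \<Rightarrow> 'b) \<Rightarrow> (nat \<Rightarrow>\<^sub>0 nat) \<Rightarrow> 'b::comm_ring_1" where
  "monom_eval \<sigma> m = (\<Prod>i \<in> Poly_Mapping.keys m. \<sigma> i ^ Poly_Mapping.lookup m i)"

text \<open>Evaluation at points, restriction to subspaces, passage to univariate polynomials and to curves
  are all substitutions: the coefficients are mapped by \<open>h\<close>, the variable \<open>X\<^sub>i\<close> goes to \<open>\<sigma> i\<close>.\<close>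

definition mpoly_subst :: "('a \<Rightarrow> 'b) \<Rightarrow> (nat \<Rightarrow> 'b) \<Rightarrow> 'a::comm_ring_1 mpoly \<Rightarrow> 'b::comm_ring_1" where
  "mpoly_subst h \<sigma> p = (\<Sum>m \<in> Poly_Mapping.keys p. h (Poly_Mapping.lookup p m) * monom_eval \<sigma> m)"

lemma monom_eval_superset:
  assumes "finite S" "Poly_Mapping.keys m \<subseteq> S"
  shows "monom_eval \<sigma> m = (\<Prod>i\<in>S. \<sigma> i ^ Poly_Mapping.lookup m i)"
  unfolding monom_eval_def
  by (rule prod.mono_neutral_left) (use assms in \<open>auto simp: in_keys_iff\<close>)

lemma monom_eval_0 [simp]: "monom_eval \<sigma> 0 = 1"
  by (simp add: monom_eval_def)

lemma monom_eval_single [simp]: "monom_eval \<sigma> (Poly_Mapping.single i e) = \<sigma> i ^ e"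
  by (simp add: monom_eval_def)

lemma monom_eval_add: "monom_eval \<sigma> (m + m') = monom_eval \<sigma> m * monom_eval \<sigma> m'"
proof -
  let ?S = "Poly_Mapping.keys m \<union> Poly_Mapping.keys m'"
  have "Poly_Mapping.keys (m + m') \<subseteq> ?S" by (rule keys_add)
  then show ?thesis
    by (simp add: monom_eval_superset[of ?S] lookup_add power_add prod.distrib)
qed

context comm_ring_hom
begin

lemma mpoly_subst_superset:
  assumes "finite S" "Poly_Mapping.keys p \<subseteq> S"
  shows "mpoly_subst hom \<sigma> p = (\<Sum>m\<in>S. hom (Poly_Mapping.lookup p m) * monom_eval \<sigma> m)"
  unfolding mpoly_subst_def
  by (rule sum.mono_neutral_left) (use assms in \<open>auto simp: in_keys_iff\<close>)

lemma mpoly_subst_single [simp]: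
  "mpoly_subst hom \<sigma> (Poly_Mapping.single m a) = hom a * monom_eval \<sigma> m"
  by (simp add: mpoly_subst_def)

lemma mpoly_subst_add:
  "mpoly_subst hom \<sigma> (p + q) = mpoly_subst hom \<sigma> p + mpoly_subst hom \<sigma> q"
proof -
  let ?S = "Poly_Mapping.keys p \<union> Poly_Mapping.keys q"
  have "Poly_Mapping.keys (p + q) \<subseteq> ?S" by (rule keys_add)
  then show ?thesis
    by (simp add: mpoly_subst_superset[of ?S] lookup_add hom_add distrib_right sum.distrib)
qed

lemma mpoly_subst_0 [simp]: "mpoly_subst hom \<sigma> 0 = 0"
  by (simp add: mpoly_subst_def)

lemma mpoly_subst_mult:
  "mpoly_subst hom \<sigma> (p * q) = mpoly_subst hom \<sigma> p * mpoly_subst hom \<sigma> q"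
proof (induction p rule: mpoly_induct)
  case (single m a)
  show ?case
    by (induction q rule: mpoly_induct)
       (simp_all add: mult_single hom_mult monom_eval_add mpoly_subst_add distrib_left)
qed (simp_all add: mpoly_subst_add distrib_right)

lemma mpoly_subst_hom: "comm_ring_hom (mpoly_subst hom \<sigma>)"
proof
  show "mpoly_subst hom \<sigma> 1 = 1"
    using mpoly_subst_single[of \<sigma> 0 1] by simp
qed (simp_all add: mpoly_subst_add mpoly_subst_mult)

lemma mpoly_subst_var [simp]: "mpoly_subst hom \<sigma> (mpoly_var i) = \<sigma> i"
  by (simp add: mpoly_var_def)

lemma mpoly_subst_const [simp]: "mpoly_subst hom \<sigma> (mpoly_const a) = hom a"
  by (simp add: mpoly_const_def)

end

lemma hom_monom_eval:
  assumes "comm_ring_hom g"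
  shows "g (monom_eval \<sigma> m) = monom_eval (g \<circ> \<sigma>) m"
proof -
  interpret comm_ring_hom g by fact
  show ?thesis by (simp add: monom_eval_def hom_prod hom_power)
qed

lemma hom_mpoly_subst:
  assumes "comm_ring_hom g"
  shows "g (mpoly_subst h \<sigma> p) = mpoly_subst (g \<circ> h) (g \<circ> \<sigma>) p"
proof -
  interpret comm_ring_hom g by fact
  show ?thesis
    by (simp add: mpoly_subst_def hom_sum hom_mult hom_monom_eval[OF assms])
qed

lemma monom_eval_cong:
  assumes "\<And>i. i \<in> Poly_Mapping.keys m \<Longrightarrow> \<sigma> i = \<tau> i"
  shows "monom_eval \<sigma> m = monom_eval \<tau> m"
  unfolding monom_eval_def by (rule prod.cong) (use assms in auto)

interpretation id_hom: comm_ring_hom "id :: 'a::comm_ring_1 \<Rightarrow> 'a"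
  by unfold_locales auto

interpretation mpoly_const_hom: comm_ring_hom "mpoly_const :: 'a::comm_ring_1 \<Rightarrow> 'a mpoly"
  by unfold_locales (auto simp: mpoly_const_def single_add mult_single)

lemma monom_eval_var: "monom_eval mpoly_var m = (Poly_Mapping.single m 1 :: 'a::comm_ring_1 mpoly)"
proof (induction m rule: update_induct)
  case const
  then show ?case by simp
next
  case (update m i e)
  have eq: "Poly_Mapping.update i e m = m + Poly_Mapping.single i e"
    by (rule poly_mapping_eqI)
       (use update in \<open>auto simp: lookup_update lookup_add lookup_single when_def in_keys_iff\<close>)
  have "(mpoly_var i :: 'a mpoly) ^ e = Poly_Mapping.single (Poly_Mapping.single i e) 1"
    by (induction e) (simp_all add: mpoly_var_def mult_single single_add[symmetric])
  then show ?case by (simp add: eq monom_eval_add update mult_single)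
qed

lemma mpoly_subst_const_var: "mpoly_subst mpoly_const mpoly_var p = p"
proof (induction p rule: mpoly_induct)
  case (single m a)
  then show ?case
    by (simp add: mpoly_const_hom.mpoly_subst_single monom_eval_var)
       (simp add: mpoly_const_def mult_single)
qed (simp_all add: mpoly_const_hom.mpoly_subst_add)

abbreviation fun_eval :: "(nat \<Rightarrow> 'a) \<Rightarrow> 'a::comm_ring_1 mpoly \<Rightarrow> 'a" where
  "fun_eval \<equiv> mpoly_subst id"

interpretation fun_eval: comm_ring_hom "fun_eval \<sigma> :: 'a::comm_ring_1 mpoly \<Rightarrow> 'a"
  by (rule id_hom.mpoly_subst_hom)

lemma mpoly_eval_eq: "mpoly_eval p x = fun_eval (vec_index x) p"
  by (simp add: mpoly_eval_def mpoly_subst_def monom_eval_def)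

interpretation mpoly_eval: comm_ring_hom "\<lambda>p :: 'a::comm_ring_1 mpoly. mpoly_eval p x"
  unfolding mpoly_eval_eq by (rule id_hom.mpoly_subst_hom)

lemma mpoly_eval_var [simp]: "mpoly_eval (mpoly_var i) x = vec_index x i"
  by (simp add: mpoly_eval_eq)

lemma mpoly_eval_const [simp]: "mpoly_eval (mpoly_const a) x = a"
  by (simp add: mpoly_eval_eq)

text \<open>The ring of polynomials in the variables of an arbitrary index set; the dimension count needs it
  for the representatives of identified coordinates, the density argument for the base variables.\<close>

definition mpolys_in :: "nat set \<Rightarrow> 'a::comm_ring_1 mpoly set" where
  "mpolys_in I = {p. \<forall>m \<in> Poly_Mapping.keys p. Poly_Mapping.keys m \<subseteq> I}"

lemma mpolys_eq: "mpolys n = mpolys_in {..<n}"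
  by (simp add: mpolys_def mpolys_in_def)

lemma mpolys_in_const [simp, intro]: "mpoly_const a \<in> mpolys_in I"
  by (auto simp: mpolys_in_def mpoly_const_def)

lemma mpolys_in_0 [simp, intro]: "0 \<in> mpolys_in I"
  by (auto simp: mpolys_in_def)

lemma mpolys_in_1 [simp, intro]: "1 \<in> mpolys_in I"
  by (auto simp: mpolys_in_def)

lemma mpolys_in_var [simp, intro]: "i \<in> I \<Longrightarrow> mpoly_var i \<in> mpolys_in I"
  by (auto simp: mpolys_in_def mpoly_var_def)

lemma mpolys_in_add [simp, intro]: "p \<in> mpolys_in I \<Longrightarrow> q \<in> mpolys_in I \<Longrightarrow> p + q \<in> mpolys_in I"
  using keys_add[of p q] by (fastforce simp: mpolys_in_def)

lemma mpolys_in_mult [simp, intro]: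
  assumes "p \<in> mpolys_in I" "q \<in> mpolys_in I"
  shows "p * q \<in> mpolys_in I"
  unfolding mpolys_in_def
proof (intro CollectI ballI)
  fix m assume "m \<in> Poly_Mapping.keys (p * q)"
  then obtain a b where ab: "m = a + b" "a \<in> Poly_Mapping.keys p" "b \<in> Poly_Mapping.keys q"
    using keys_mult[of p q] by auto
  then have "Poly_Mapping.keys a \<subseteq> I" "Poly_Mapping.keys b \<subseteq> I"
    using assms by (auto simp: mpolys_in_def)
  then show "Poly_Mapping.keys m \<subseteq> I" using keys_add[of a b] ab(1) by auto
qed

lemma mpolys_in_diff [simp, intro]:
  assumes "p \<in> mpolys_in I" "q \<in> mpolys_in I"
  shows "p - q \<in> mpolys_in I"
proof -
  have eq: "p - q = p + mpoly_const (-1) * q"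
    by (simp only: mpoly_const_hom.hom_uminus mpoly_const_hom.hom_one) simp
  show ?thesis unfolding eq using assms by (intro mpolys_in_add mpolys_in_mult) auto
qed

lemma mpolys_in_sum [intro]: "(\<And>i. i \<in> A \<Longrightarrow> f i \<in> mpolys_in I) \<Longrightarrow> sum f A \<in> mpolys_in I"
  by (induction A rule: infinite_finite_induct) auto

lemma mpolys_in_power [simp, intro]: "p \<in> mpolys_in I \<Longrightarrow> p ^ e \<in> mpolys_in I"
  by (induction e) auto

lemma mpolys_in_prod [intro]: "(\<And>i. i \<in> A \<Longrightarrow> f i \<in> mpolys_in I) \<Longrightarrow> prod f A \<in> mpolys_in I"
  by (induction A rule: infinite_finite_induct) auto

lemma mpolys_in_subst:
  assumes "\<And>i. i \<in> J \<Longrightarrow> \<sigma> i \<in> mpolys_in I" "p \<in> mpolys_in J"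
  shows "mpoly_subst mpoly_const \<sigma> p \<in> mpolys_in I"
  unfolding mpoly_subst_def monom_eval_def
  by (intro mpolys_in_sum mpolys_in_mult mpolys_in_prod mpolys_in_power)
     (use assms in \<open>auto simp: mpolys_in_def[of J]\<close>)

lemma mpoly_subst_cong:
  assumes "p \<in> mpolys_in I" "\<And>i. i \<in> I \<Longrightarrow> \<sigma> i = \<tau> i"
  shows "mpoly_subst h \<sigma> p = mpoly_subst h \<tau> p"
  unfolding mpoly_subst_def
  by (intro sum.cong refl arg_cong2[of _ _ _ _ "(*)"] monom_eval_cong)
     (use assms in \<open>auto simp: mpolys_in_def\<close>)

text \<open>Two distinct monomials differ in the exponent of some variable. Scaling that variable by \<open>t\<close>
  separates the relation by powers of \<open>t\<close>, and the part that contains \<open>m\<close> is a shorter relation.\<close>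

lemma monomials_independent:
  fixes a :: "(nat \<Rightarrow>\<^sub>0 nat) \<Rightarrow> 'a::field"
  assumes inf: "infinite (UNIV :: 'a set)"
  assumes "finite M" "\<And>\<sigma>. (\<Sum>m\<in>M. a m * monom_eval \<sigma> m) = 0" "m \<in> M"
  shows "a m = 0"
  using assms(2-)
proof (induction "card M" arbitrary: M m rule: less_induct)
  case less
  show ?case
  proof (cases "M = {m}")
    case True
    then show ?thesis using less.prems(2)[of "\<lambda>_. 1"] by (simp add: monom_eval_def)
  next
    case False
    then obtain m' where m': "m' \<in> M" "m' \<noteq> m" using less.prems by auto
    then obtain i where i: "Poly_Mapping.lookup m' i \<noteq> Poly_Mapping.lookup m i"
      by (meson poly_mapping_eqI)
    let ?M = "{l\<in>M. Poly_Mapping.lookup l i = Poly_Mapping.lookup m i}"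
    have "?M \<subset> M" using m' i by auto
    then have card: "card ?M < card M" using less.prems(1) psubset_card_mono by blast
    have "(\<Sum>l\<in>?M. a l * monom_eval \<sigma> l) = 0" for \<sigma>
    proof -
      \<comment> \<open>scaling the \<open>i\<close>-th coordinate by \<open>t\<close> turns the relation into a polynomial in \<open>t\<close>\<close>
      define p where "p = (\<Sum>l\<in>M. monom (a l * monom_eval \<sigma> l) (Poly_Mapping.lookup l i))"
      have "poly p t = 0" for t
      proof -
        have "monom_eval (\<sigma>(i := t * \<sigma> i)) l = monom_eval \<sigma> l * t ^ Poly_Mapping.lookup l i" for l
        proof -
          let ?S = "insert i (Poly_Mapping.keys l)"
          have S: "monom_eval \<tau> l = (\<Prod>j\<in>?S. \<tau> j ^ Poly_Mapping.lookup l j)" for \<tau> :: "nat \<Rightarrow> 'a"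
            by (rule monom_eval_superset) auto
          have "monom_eval (\<sigma>(i := t * \<sigma> i)) l
              = (\<Prod>j\<in>?S. \<sigma> j ^ Poly_Mapping.lookup l j * (if j = i then t ^ Poly_Mapping.lookup l i else 1))"
            unfolding S by (rule prod.cong) (auto simp: power_mult_distrib)
          also have "\<dots> = monom_eval \<sigma> l * t ^ Poly_Mapping.lookup l i"
            unfolding S prod.distrib by simp
          finally show ?thesis .
        qed
        then have "poly p t = (\<Sum>l\<in>M. a l * monom_eval (\<sigma>(i := t * \<sigma> i)) l)"
          by (simp add: p_def poly_sum poly_monom mult_ac)
        then show ?thesis using less.prems(2) by simp
      qed
      then have "p = 0" using inf poly_roots_finite[of p] by auto
      then have "coeff p (Poly_Mapping.lookup m i) = 0" by simp
      then show ?thesis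
        using less.prems(1)
        by (simp add: p_def coeff_sum if_distrib sum.If_cases Int_def cong: if_cong)
    qed
    from less.hyps[OF card _ this] less.prems show ?thesis by auto
  qed
qed

lemma mpoly_eq_0I:
  fixes p :: "'a::field mpoly"
  assumes "infinite (UNIV :: 'a set)" "\<And>\<sigma>. fun_eval \<sigma> p = 0"
  shows "p = 0"
proof (rule poly_mapping_eqI)
  fix m
  show "Poly_Mapping.lookup p m = Poly_Mapping.lookup 0 m"
  proof (cases "m \<in> Poly_Mapping.keys p")
    case True
    have "Poly_Mapping.lookup p m = 0"
      by (rule monomials_independent[OF assms(1) _ _ True])
         (use assms(2) in \<open>auto simp: mpoly_subst_def\<close>)
    then show ?thesis by simp
  qed (simp add: in_keys_iff)
qed



section \<open>Algebraic dependence and the length of chains\<close>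

text \<open>A homogeneous system with more unknowns than equations, solved by Gaussian elimination on one
  equation at a time.\<close>

lemma linear_system_nontrivial:
  fixes M :: "'b \<Rightarrow> 'e \<Rightarrow> 'k::field"
  assumes "finite B" "finite E" "card B < card E"
  shows "\<exists>a. (\<exists>e\<in>E. a e \<noteq> 0) \<and> (\<forall>b\<in>B. (\<Sum>e\<in>E. a e * M b e) = 0)"
  using assms
proof (induction B arbitrary: E M rule: finite_induct)
  case empty
  then obtain e where "e \<in> E" by fastforce
  then show ?case by (intro exI[of _ "\<lambda>_. 1"]) auto
next
  case (insert b B)
  show ?case
  proof (cases "\<forall>e\<in>E. M b e = 0")
    case True
    have "card B < card E" using insert by simp
    then obtain a where "\<exists>e\<in>E. a e \<noteq> 0" "\<forall>b\<in>B. (\<Sum>e\<in>E. a e * M b e) = 0"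
      using insert.IH[OF insert.prems(1), of M] by blast
    then show ?thesis using True by (intro exI[of _ a]) auto
  next
    case False
    then obtain e0 where e0: "e0 \<in> E" "M b e0 \<noteq> 0" by auto
    let ?E = "E - {e0}"
    \<comment> \<open>the other equations after elimination of the unknown \<open>e0\<close>\<close>
    let ?N = "\<lambda>b' e. M b' e - M b' e0 * M b e / M b e0"
    have "finite ?E" "card B < card ?E" using insert e0 by auto
    then obtain a where a: "\<exists>e\<in>?E. a e \<noteq> 0" "\<forall>b'\<in>B. (\<Sum>e\<in>?E. a e * ?N b' e) = 0"
      using insert.IH[of ?E ?N] by blast
    define s where "s = - (\<Sum>e\<in>?E. a e * M b e) / M b e0"
    define a' where "a' = a(e0 := s)"
    have sum: "(\<Sum>e\<in>E. a' e * M b' e) = s * M b' e0 + (\<Sum>e\<in>?E. a e * M b' e)" for b'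
      by (subst sum.remove[OF insert.prems(1) e0(1)]) (auto simp: a'_def intro!: sum.cong)
    have "(\<Sum>e\<in>E. a' e * M b' e) = 0" if "b' \<in> insert b B" for b'
    proof (cases "b' = b")
      case True
      then show ?thesis unfolding sum s_def using e0 by simp
    next
      case False
      then have "(\<Sum>e\<in>?E. a e * ?N b' e) = 0" using that a by auto
      also have "(\<Sum>e\<in>?E. a e * ?N b' e) = (\<Sum>e\<in>?E. a e * M b' e) - (\<Sum>e\<in>?E. a e * M b e) * (M b' e0 / M b e0)"
        by (simp add: right_diff_distrib sum_subtractf sum_distrib_left sum_distrib_right sum_divide_distrib mult_ac)
      finally show ?thesis unfolding sum s_def using e0 by (simp add: field_simps)
    qed
    moreover have "\<exists>e\<in>E. a' e \<noteq> 0" using a(1) by (auto simp: a'_def)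
    ultimately show ?thesis by blast
  qed
qed

definition exponents_le :: "'a::comm_ring_1 mpoly \<Rightarrow> nat \<Rightarrow> bool" where
  "exponents_le p L \<longleftrightarrow> (\<forall>m\<in>Poly_Mapping.keys p. \<forall>i. Poly_Mapping.lookup m i \<le> L)"

lemma exponents_le_ex: "\<exists>L. exponents_le p L"
proof -
  have "Poly_Mapping.lookup m i \<le> (\<Sum>m\<in>Poly_Mapping.keys p. \<Sum>i\<in>Poly_Mapping.keys m. Poly_Mapping.lookup m i)"
    if m: "m \<in> Poly_Mapping.keys p" for m i
  proof (cases "i \<in> Poly_Mapping.keys m")
    case True
    then have "Poly_Mapping.lookup m i \<le> (\<Sum>i\<in>Poly_Mapping.keys m. Poly_Mapping.lookup m i)"
      by (intro member_le_sum) auto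
    also have "\<dots> \<le> (\<Sum>m\<in>Poly_Mapping.keys p. \<Sum>i\<in>Poly_Mapping.keys m. Poly_Mapping.lookup m i)"
      using m by (intro member_le_sum) auto
    finally show ?thesis .
  qed (simp add: in_keys_iff)
  then show ?thesis unfolding exponents_le_def by blast
qed

lemma exponents_le_mono: "exponents_le p L \<Longrightarrow> L \<le> L' \<Longrightarrow> exponents_le p L'"
  unfolding exponents_le_def by (meson le_trans)

lemma exponents_le_1: "exponents_le 1 L"
  by (simp add: exponents_le_def)

lemma exponents_le_mult:
  assumes "exponents_le p L" "exponents_le q L'"
  shows "exponents_le (p * q) (L + L')"
  unfolding exponents_le_def
proof (intro ballI allI)
  fix m i assume "m \<in> Poly_Mapping.keys (p * q)"
  then obtain a b where "m = a + b" "a \<in> Poly_Mapping.keys p" "b \<in> Poly_Mapping.keys q"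
    using keys_mult[of p q] by auto
  then show "Poly_Mapping.lookup m i \<le> L + L'"
    using assms by (auto simp: exponents_le_def lookup_add intro!: add_mono)
qed

lemma exponents_le_power: "exponents_le p L \<Longrightarrow> exponents_le (p ^ e) (e * L)"
  by (induction e) (auto simp: exponents_le_1 intro: exponents_le_mult)

lemma exponents_le_prod:
  "finite A \<Longrightarrow> (\<And>j. j \<in> A \<Longrightarrow> exponents_le (p j) (L j)) \<Longrightarrow> exponents_le (prod p A) (sum L A)"
  by (induction A rule: finite_induct) (auto simp: exponents_le_1 intro: exponents_le_mult)

lemma lookup_const_mult:
  "Poly_Mapping.lookup (mpoly_const c * p) m = c * Poly_Mapping.lookup p m"
  unfolding mpoly_const_def mult_map_scale_conv_mult[symmetric]
  by (simp add: map.rep_eq when_def)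

lemma card_bounded_exponents:
  fixes L :: nat
  assumes "finite R"
  defines "B \<equiv> {m. Poly_Mapping.keys m \<subseteq> R \<and> (\<forall>i. Poly_Mapping.lookup m i \<le> L)}"
  shows "finite B" "card B \<le> (L + 1) ^ card R"
proof -
  let ?P = "PiE R (\<lambda>_. {..L})"
  let ?g = "\<lambda>m. restrict (Poly_Mapping.lookup m) R"
  have inj: "inj_on ?g B"
  proof (rule inj_onI)
    fix m m' assume m: "m \<in> B" "m' \<in> B" and eq: "?g m = ?g m'"
    show "m = m'"
    proof (rule poly_mapping_eqI)
      fix i
      show "Poly_Mapping.lookup m i = Poly_Mapping.lookup m' i"
      proof (cases "i \<in> R")
        case True
        then show ?thesis using fun_cong[OF eq, of i] by simp
      next
        case False
        then have "i \<notin> Poly_Mapping.keys m" "i \<notin> Poly_Mapping.keys m'" using m by (auto simp: B_def)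
        then show ?thesis by (simp add: in_keys_iff)
      qed
    qed
  qed
  have img: "?g ` B \<subseteq> ?P" by (auto simp: B_def)
  have fin: "finite ?P" using assms by (intro finite_PiE) auto
  show "finite B" using inj_on_finite[OF inj img fin] .
  have "card B \<le> card ?P" by (rule card_inj_on_le[OF inj img fin])
  also have "card ?P = (L + 1) ^ card R" using assms by (simp add: card_PiE)
  finally show "card B \<le> (L + 1) ^ card R" .
qed

text \<open>Products of powers \<open>f\<^sub>0\<^bsup>e\<^sub>0\<^esup> \<cdots> f\<^bsub>r-1\<^esub>\<^bsup>e\<^bsub>r-1\<^esub>\<^esup>\<close> with all exponents below \<open>N\<close> number \<open>N\<^sup>r\<close>, but they lie in a
  space of dimension \<open>O(N\<^bsup>card R\<^esup>)\<close>. The relation is given by the set \<open>M\<close> of exponents with nonzero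
  coefficient; injectivity of restriction says that its members are distinct monomials in the \<open>f\<^sub>j\<close>.\<close>

lemma algebraic_dependence:
  fixes f :: "nat \<Rightarrow> 'k::field mpoly"
  assumes R: "finite R" "card R < r" and f: "\<And>j. j < r \<Longrightarrow> f j \<in> mpolys_in R"
  obtains M a where "finite M" "M \<noteq> {}" "inj_on (\<lambda>e. restrict e {..<r}) M" "\<forall>e\<in>M. a e \<noteq> 0"
    "(\<Sum>e\<in>M. mpoly_const (a e) * (\<Prod>j<r. f j ^ e j)) = 0"
proof -
  have "\<forall>j. \<exists>L. exponents_le (f j) L" by (blast intro: exponents_le_ex)
  then obtain D0 where D0: "\<And>j. exponents_le (f j) (D0 j)" by metis
  define D where "D = (\<Sum>j<r. D0 j)"
  have D: "exponents_le (f j) D" if "j < r" for j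
    by (rule exponents_le_mono[OF D0]) (use that in \<open>auto simp: D_def intro: member_le_sum\<close>)
  let ?s = "card R"
  \<comment> \<open>large enough that \<open>N\<^sup>r\<close> exceeds the number \<open>(L + 1) ^ ?s\<close> of available monomials\<close>
  define N where "N = (r * D + 1) ^ ?s + 1"
  define L where "L = r * (N * D)"
  define B where "B = {m. Poly_Mapping.keys m \<subseteq> R \<and> (\<forall>i. Poly_Mapping.lookup m i \<le> L)}"
  define E where "E = PiE {..<r} (\<lambda>_. {..<N})"
  define F where "F e = (\<Prod>j<r. f j ^ e j)" for e :: "nat \<Rightarrow> nat"
  have finE: "finite E" unfolding E_def by (intro finite_PiE) auto
  have B: "finite B" "card B \<le> (L + 1) ^ ?s"
    unfolding B_def using card_bounded_exponents[OF R(1)] by blast+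
  have "L + 1 \<le> (r * D + 1) * N" by (simp add: L_def N_def algebra_simps)
  then have "(L + 1) ^ ?s \<le> ((r * D + 1) * N) ^ ?s" by (rule power_mono) simp
  also have "\<dots> = (r * D + 1) ^ ?s * N ^ ?s" by (rule power_mult_distrib)
  also have "\<dots> < N * N ^ ?s" by (intro mult_strict_right_mono) (auto simp: N_def)
  also have "N * N ^ ?s = N ^ Suc ?s" by simp
  also have "\<dots> \<le> N ^ r" using R(2) by (intro power_increasing) (auto simp: N_def)
  finally have "card B < card E" using B(2) by (simp add: E_def card_PiE)
  then obtain a where a: "\<exists>e\<in>E. a e \<noteq> 0"
    "\<And>b. b \<in> B \<Longrightarrow> (\<Sum>e\<in>E. a e * Poly_Mapping.lookup (F e) b) = 0"
    using linear_system_nontrivial[OF B(1) finE, of "\<lambda>b e. Poly_Mapping.lookup (F e) b"] by blast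
  have keys: "Poly_Mapping.keys (F e) \<subseteq> B" if "e \<in> E" for e
  proof -
    have 1: "F e \<in> mpolys_in R" unfolding F_def using f by auto
    have "exponents_le (F e) (\<Sum>j<r. e j * D)" unfolding F_def
      using D by (intro exponents_le_prod exponents_le_power) auto
    moreover have "(\<Sum>j<r. e j * D) \<le> (\<Sum>j<r. N * D)"
      using that by (intro sum_mono mult_right_mono) (auto simp: E_def PiE_def Pi_def intro: less_imp_le)
    ultimately have 2: "exponents_le (F e) L" by (auto simp: L_def intro: exponents_le_mono)
    show ?thesis using 1 2 by (auto simp: B_def mpolys_in_def exponents_le_def)
  qed
  define M where "M = {e\<in>E. a e \<noteq> 0}"
  have "(\<Sum>e\<in>M. mpoly_const (a e) * F e) = 0"
  proof (rule poly_mapping_eqI)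
    fix b
    have "Poly_Mapping.lookup (\<Sum>e\<in>M. mpoly_const (a e) * F e) b = (\<Sum>e\<in>M. a e * Poly_Mapping.lookup (F e) b)"
      by (simp add: lookup_sum lookup_const_mult)
    also have "\<dots> = (\<Sum>e\<in>E. a e * Poly_Mapping.lookup (F e) b)"
      by (rule sum.mono_neutral_left) (auto simp: M_def finE)
    also have "\<dots> = 0"
    proof (cases "b \<in> B")
      case False
      then show ?thesis using keys by (intro sum.neutral ballI) (metis in_keys_iff mult_zero_right subsetD)
    qed (rule a(2))
    finally show "Poly_Mapping.lookup (\<Sum>e\<in>M. mpoly_const (a e) * F e) b = Poly_Mapping.lookup 0 b" by simp
  qed
  moreover have "inj_on (\<lambda>e. restrict e {..<r}) M"
    by (rule inj_onI) (auto simp: M_def E_def PiE_def extensional_restrict)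
  ultimately show ?thesis using a(1) finE
    by (intro that[of M a]) (auto simp: M_def F_def)
qed

text \<open>The vanishing ideal is prime. Unlike \<open>irreducible_variety\<close> this also makes sense for a set that
  is not known to be closed, such as the top member of an extended chain.\<close>

definition irreducible_set :: "nat \<Rightarrow> 'k::field vec set \<Rightarrow> bool" where
  "irreducible_set n W \<longleftrightarrow> W \<subseteq> carrier_vec n \<and> W \<noteq> {} \<and>
     (\<forall>p\<in>mpolys n. \<forall>q\<in>mpolys n. (\<forall>x\<in>W. mpoly_eval p x * mpoly_eval q x = 0) \<longrightarrow>
        (\<forall>x\<in>W. mpoly_eval p x = 0) \<or> (\<forall>x\<in>W. mpoly_eval q x = 0))"

text \<open>Each \<open>f\<^sub>j\<close> vanishes on \<open>C\<^sub>j\<close> but not on \<open>C\<^bsub>j+1\<^esub>\<close>. Divide a relation on the top set by the largest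
  possible power of the last function, which is allowed there by primality, and restrict to the
  next lower set: the terms that still contain the last function disappear, and what remains is
  a nontrivial relation between the others. At the bottom a nonzero constant vanishes on a
  nonempty set.\<close>

lemma chain_no_relation:
  fixes C :: "nat \<Rightarrow> 'k::field vec set"
  assumes "\<And>j. j \<le> r \<Longrightarrow> irreducible_set n (C j)" "\<And>j. j < r \<Longrightarrow> C j \<subseteq> C (Suc j)"
    "\<And>j. j < r \<Longrightarrow> f j \<in> mpolys n"
    "\<And>j x. j < r \<Longrightarrow> x \<in> C j \<Longrightarrow> mpoly_eval (f j) x = 0"
    "\<And>j. j < r \<Longrightarrow> \<exists>x\<in>C (Suc j). mpoly_eval (f j) x \<noteq> 0"
    "finite M" "M \<noteq> {}" "inj_on (\<lambda>e. restrict e {..<r}) M" "\<forall>e\<in>M. a e \<noteq> 0"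
    "\<And>x. x \<in> C r \<Longrightarrow> (\<Sum>e\<in>M. a e * (\<Prod>j<r. mpoly_eval (f j) x ^ e j)) = 0"
  shows False
  using assms
proof (induction r arbitrary: M)
  case 0
  then obtain e where e: "e \<in> M" by auto
  have "M = {e}" using 0(8) e by (auto simp: inj_on_def)
  moreover obtain x where "x \<in> C 0" using 0(1)[of 0] by (auto simp: irreducible_set_def)
  ultimately show ?case using 0(9) 0(10)[of x] by auto
next
  case (Suc r)
  \<comment> \<open>the power of the last function that divides the relation\<close>
  define \<mu> where "\<mu> = Min ((\<lambda>e. e r) ` M)"
  have \<mu>: "\<mu> \<le> e r" if "e \<in> M" for e unfolding \<mu>_def using that Suc.prems(6) by auto
  define M' where "M' = {e\<in>M. e r = \<mu>}"
  have "\<mu> \<in> (\<lambda>e. e r) ` M" unfolding \<mu>_def using Suc.prems(6,7) by (intro Min_in) auto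
  then have M': "finite M'" "M' \<noteq> {}" using Suc.prems(6) by (auto simp: M'_def)
  have inj: "inj_on (\<lambda>e. restrict e {..<r}) M'"
  proof (rule inj_onI)
    fix e e' assume e: "e \<in> M'" "e' \<in> M'" "restrict e {..<r} = restrict e' {..<r}"
    have "e j = e' j" if "j < Suc r" for j
    proof (cases "j = r")
      case True then show ?thesis using e by (auto simp: M'_def)
    next
      case False
      then show ?thesis using that fun_cong[OF e(3), of j] by auto
    qed
    then have "restrict e {..<Suc r} = restrict e' {..<Suc r}" by (auto simp: restrict_def)
    then show "e = e'" by (rule inj_onD[OF Suc.prems(8)]) (use e in \<open>auto simp: M'_def\<close>)
  qed
  define g where "g = (\<Sum>e\<in>M. mpoly_const (a e) * (\<Prod>j<r. f j ^ e j) * f r ^ (e r - \<mu>))"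
  have gin: "g \<in> mpolys n" unfolding g_def mpolys_eq
    by (intro mpolys_in_sum mpolys_in_mult mpolys_in_prod mpolys_in_power mpolys_in_const)
       (use Suc.prems(3) in \<open>auto simp: mpolys_eq\<close>)
  have g_eval: "mpoly_eval g x = (\<Sum>e\<in>M. a e * (\<Prod>j<r. mpoly_eval (f j) x ^ e j) * mpoly_eval (f r) x ^ (e r - \<mu>))" for x
    by (simp add: g_def mpoly_eval.hom_sum mpoly_eval.hom_mult mpoly_eval.hom_prod mpoly_eval.hom_power)
  have "mpoly_eval g x * mpoly_eval (f r ^ \<mu>) x = 0" if "x \<in> C (Suc r)" for x
  proof -
    have "mpoly_eval g x * mpoly_eval (f r ^ \<mu>) x = (\<Sum>e\<in>M. a e * (\<Prod>j<Suc r. mpoly_eval (f j) x ^ e j))"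
      unfolding g_eval mpoly_eval.hom_power sum_distrib_right
    proof (rule sum.cong)
      fix e assume "e \<in> M"
      then have "mpoly_eval (f r) x ^ e r = mpoly_eval (f r) x ^ (e r - \<mu>) * mpoly_eval (f r) x ^ \<mu>"
        using \<mu> by (simp flip: power_add)
      then show "a e * (\<Prod>j<r. mpoly_eval (f j) x ^ e j) * mpoly_eval (f r) x ^ (e r - \<mu>) * mpoly_eval (f r) x ^ \<mu>
          = a e * (\<Prod>j<Suc r. mpoly_eval (f j) x ^ e j)"
        by (simp only: prod.lessThan_Suc mult.assoc)
    qed simp
    also have "\<dots> = 0" using Suc.prems(10) that by simp
    finally show ?thesis .
  qed
  moreover have "f r ^ \<mu> \<in> mpolys n" using Suc.prems(3) unfolding mpolys_eq by auto
  moreover have "\<exists>x\<in>C (Suc r). mpoly_eval (f r ^ \<mu>) x \<noteq> 0"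
    using Suc.prems(5)[of r] by (auto simp: mpoly_eval.hom_power)
  ultimately have "\<forall>x\<in>C (Suc r). mpoly_eval g x = 0"
    using Suc.prems(1)[of "Suc r"] gin unfolding irreducible_set_def by blast
  then have g0: "mpoly_eval g x = 0" if "x \<in> C r" for x using Suc.prems(2)[of r] that by auto
  have rel: "(\<Sum>e\<in>M'. a e * (\<Prod>j<r. mpoly_eval (f j) x ^ e j)) = 0" if x: "x \<in> C r" for x
  proof -
    have "0 = mpoly_eval g x" using g0 x by simp
    also have "\<dots> = (\<Sum>e\<in>M. if e r = \<mu> then a e * (\<Prod>j<r. mpoly_eval (f j) x ^ e j) else 0)"
      unfolding g_eval
    proof (rule sum.cong)
      fix e assume e: "e \<in> M"
      have "mpoly_eval (f r) x = 0" using Suc.prems(4)[of r x] x by simp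
      moreover have "e r - \<mu> = 0 \<longleftrightarrow> e r = \<mu>" using \<mu>[OF e] by auto
      ultimately show "a e * (\<Prod>j<r. mpoly_eval (f j) x ^ e j) * mpoly_eval (f r) x ^ (e r - \<mu>)
          = (if e r = \<mu> then a e * (\<Prod>j<r. mpoly_eval (f j) x ^ e j) else 0)"
        by (simp add: power_0_left)
    qed simp
    also have "\<dots> = (\<Sum>e\<in>M'. a e * (\<Prod>j<r. mpoly_eval (f j) x ^ e j))"
      unfolding M'_def using Suc.prems(6) by (simp add: sum.inter_filter)
    finally show ?thesis by simp
  qed
  have "\<forall>e\<in>M'. a e \<noteq> 0" using Suc.prems(9) by (simp add: M'_def)
  from Suc.IH[OF Suc.prems(1-5) M' inj this rel] show ?case by simp
qed

lemma algebraic_set_carrier: "algebraic_set n A \<Longrightarrow> A \<subseteq> carrier_vec n"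
  by (auto simp: algebraic_set_def zero_set_def)

lemma algebraic_set_separate:
  assumes "algebraic_set n A" "B \<subseteq> carrier_vec n" "\<not> B \<subseteq> A"
  shows "\<exists>p\<in>mpolys n. (\<forall>x\<in>A. mpoly_eval p x = 0) \<and> (\<exists>x\<in>B. mpoly_eval p x \<noteq> 0)"
  using assms unfolding algebraic_set_def zero_set_def by blast

text \<open>A set on which the coordinate \<open>i\<close> equals the coordinate \<open>\<rho> i\<close> has only \<open>card R\<close> independent
  coordinates. With \<open>\<rho> = id\<close> this bounds the dimension of affine space.\<close>

lemma chain_length_le:
  fixes C :: "nat \<Rightarrow> 'k::field vec set"
  assumes R: "R \<subseteq> {..<n}" "\<And>i. i < n \<Longrightarrow> \<rho> i \<in> R"
  assumes L: "\<And>x i. x \<in> C r \<Longrightarrow> i < n \<Longrightarrow> x $ i = x $ \<rho> i"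
  assumes irr: "\<And>j. j \<le> r \<Longrightarrow> irreducible_set n (C j)"
    and alg: "\<And>j. j < r \<Longrightarrow> algebraic_set n (C j)"
    and sub: "\<And>j. j < r \<Longrightarrow> C j \<subset> C (Suc j)"
  shows "r \<le> card R"
proof (rule ccontr)
  assume "\<not> r \<le> card R"
  then have less: "card R < r" by simp
  have "\<exists>p\<in>mpolys n. (\<forall>x\<in>C j. mpoly_eval p x = 0) \<and> (\<exists>x\<in>C (Suc j). mpoly_eval p x \<noteq> 0)" if j: "j < r" for j
  proof -
    have "C (Suc j) \<subseteq> carrier_vec n" using irr[of "Suc j"] j by (simp add: irreducible_set_def)
    moreover have "\<not> C (Suc j) \<subseteq> C j" using sub[OF j] by blast
    ultimately show ?thesis by (rule algebraic_set_separate[OF alg[OF j]])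
  qed
  then have "\<forall>j. \<exists>p. j < r \<longrightarrow> p \<in> mpolys n \<and> (\<forall>x\<in>C j. mpoly_eval p x = 0) \<and> (\<exists>x\<in>C (Suc j). mpoly_eval p x \<noteq> 0)"
    by blast
  from choice[OF this] obtain f where f: "\<And>j. j < r \<Longrightarrow> f j \<in> mpolys n"
    "\<And>j x. j < r \<Longrightarrow> x \<in> C j \<Longrightarrow> mpoly_eval (f j) x = 0"
    "\<And>j. j < r \<Longrightarrow> \<exists>x\<in>C (Suc j). mpoly_eval (f j) x \<noteq> 0"
    by blast
  define g where "g j = mpoly_subst mpoly_const (\<lambda>i. mpoly_var (\<rho> i)) (f j)" for j
  have g: "g j \<in> mpolys_in R" if "j < r" for j
    unfolding g_def by (rule mpolys_in_subst[of "{..<n}"]) (use R(2) f(1)[OF that] in \<open>auto simp: mpolys_eq\<close>)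
  have finR: "finite R" using R(1) finite_subset by auto
  obtain M a where M: "finite M" "M \<noteq> {}"
    "inj_on (\<lambda>e. restrict e {..<r}) M" "\<forall>e\<in>M. a e \<noteq> 0"
    "(\<Sum>e\<in>M. mpoly_const (a e) * (\<Prod>j<r. g j ^ e j)) = 0"
    by (rule algebraic_dependence[OF finR less g])
  have eval_g: "mpoly_eval (g j) x = mpoly_eval (f j) x" if x: "x \<in> C r" and j: "j < r" for x j
  proof -
    have "mpoly_eval (g j) x = mpoly_subst ((\<lambda>p. mpoly_eval p x) \<circ> mpoly_const) ((\<lambda>p. mpoly_eval p x) \<circ> (\<lambda>i. mpoly_var (\<rho> i))) (f j)"
      unfolding g_def by (rule hom_mpoly_subst) unfold_locales
    also have "\<dots> = fun_eval (\<lambda>i. x $ \<rho> i) (f j)" by (simp add: o_def id_def)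
    also have "\<dots> = mpoly_eval (f j) x"
      unfolding mpoly_eval_eq by (rule mpoly_subst_cong[OF f(1)[OF j, unfolded mpolys_eq]]) (use L x in auto)
    finally show ?thesis .
  qed
  have rel: "(\<Sum>e\<in>M. a e * (\<Prod>j<r. mpoly_eval (f j) x ^ e j)) = 0" if x: "x \<in> C r" for x
  proof -
    have "0 = mpoly_eval (\<Sum>e\<in>M. mpoly_const (a e) * (\<Prod>j<r. g j ^ e j)) x"
      unfolding M(5) by simp
    also have "\<dots> = (\<Sum>e\<in>M. a e * (\<Prod>j<r. mpoly_eval (f j) x ^ e j))"
      by (simp add: mpoly_eval.hom_sum mpoly_eval.hom_mult mpoly_eval.hom_prod mpoly_eval.hom_power eval_g[OF x])
    finally show ?thesis by simp
  qed
  show False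
  proof (rule chain_no_relation[of r n C f M a, OF irr _ f M(1-4) rel])
    show "C j \<subseteq> C (Suc j)" if "j < r" for j using sub[OF that] by (rule psubset_imp_subset)
  qed
qed

lemma irreducible_variety_iff:
  "irreducible_variety n W \<longleftrightarrow> algebraic_set n W \<and> irreducible_set n W"
proof (intro iffI conjI)
  assume W: "irreducible_variety n W"
  then show alg: "algebraic_set n W" by (simp add: irreducible_variety_def)
  show "irreducible_set n W" unfolding irreducible_set_def
  proof (intro conjI ballI impI)
    show "W \<subseteq> carrier_vec n" using alg by (rule algebraic_set_carrier)
    show "W \<noteq> {}" using W by (simp add: irreducible_variety_def)
    fix p q assume pq: "p \<in> mpolys n" "q \<in> mpolys n" "\<forall>x\<in>W. mpoly_eval p x * mpoly_eval q x = 0"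
    obtain S where S: "S \<subseteq> mpolys n" "W = zero_set n S" using alg by (auto simp: algebraic_set_def)
    let ?A = "zero_set n (insert p S)" and ?B = "zero_set n (insert q S)"
    have "algebraic_set n ?A" "algebraic_set n ?B"
      unfolding algebraic_set_def using S pq by blast+
    moreover have "W = ?A \<union> ?B" using S pq by (auto simp: zero_set_def)
    ultimately have "W = ?A \<or> W = ?B" using W unfolding irreducible_variety_def by blast
    then show "(\<forall>x\<in>W. mpoly_eval p x = 0) \<or> (\<forall>x\<in>W. mpoly_eval q x = 0)"
      by (auto simp: zero_set_def)
  qed
next
  assume W: "algebraic_set n W \<and> irreducible_set n W"
  show "irreducible_variety n W" unfolding irreducible_variety_def
  proof (intro conjI allI impI)
    show "algebraic_set n W" "W \<noteq> {}" using W by (auto simp: irreducible_set_def)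
    fix A B assume AB: "algebraic_set n A" "algebraic_set n B" "W = A \<union> B"
    show "W = A \<or> W = B"
    proof (rule ccontr)
      assume "\<not> (W = A \<or> W = B)"
      then have not_sub: "\<not> W \<subseteq> A" "\<not> W \<subseteq> B" using AB by auto
      have car: "W \<subseteq> carrier_vec n" using W by (simp add: irreducible_set_def)
      obtain p where p: "p \<in> mpolys n" "\<forall>x\<in>A. mpoly_eval p x = 0" "\<exists>x\<in>W. mpoly_eval p x \<noteq> 0"
        using algebraic_set_separate[OF AB(1) car not_sub(1)] by blast
      obtain q where q: "q \<in> mpolys n" "\<forall>x\<in>B. mpoly_eval q x = 0" "\<exists>x\<in>W. mpoly_eval q x \<noteq> 0"
        using algebraic_set_separate[OF AB(2) car not_sub(2)] by blast
      have "\<forall>x\<in>W. mpoly_eval p x * mpoly_eval q x = 0" using AB(3) p(2) q(2) by auto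
      then show False using W p(1,3) q(1,3) unfolding irreducible_set_def by blast
    qed
  qed
qed



section \<open>Descending chains of closed sets\<close>

lemma nat_seq_mono_subseq:
  fixes g :: "nat \<Rightarrow> nat"
  shows "\<exists>\<phi> :: nat \<Rightarrow> nat. strict_mono \<phi> \<and> mono (\<lambda>i. g (\<phi> i))"
proof -
  obtain \<phi> :: "nat \<Rightarrow> nat" where \<phi>: "strict_mono \<phi>" "monoseq (\<lambda>i. g (\<phi> i))" using seq_monosub[of g] by auto
  show ?thesis
  proof (cases "incseq (\<lambda>i. g (\<phi> i))")
    case True
    then show ?thesis using \<phi>(1) by auto
  next
    case False
    then have dec: "decseq (\<lambda>i. g (\<phi> i))" using \<phi>(2) by (auto simp: monoseq_iff)
    obtain N where N: "\<And>i. g (\<phi> N) \<le> g (\<phi> i)"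
      using ex_has_least_nat[of "\<lambda>_. True" 0 "\<lambda>i. g (\<phi> i)"] by auto
    have "g (\<phi> (N + i)) = g (\<phi> N)" for i
      using N[of "N + i"] decseqD[OF dec, of N "N + i"] by simp
    then have "mono (\<lambda>i. g (\<phi> (N + i)))" by (simp add: monoI)
    moreover have "strict_mono (\<lambda>i. \<phi> (N + i))" using \<phi>(1) by (simp add: strict_mono_def)
    ultimately show ?thesis by (intro exI[of _ "\<lambda>i. \<phi> (N + i)"]) simp
  qed
qed

lemma exponents_mono_subseq:
  fixes g :: "nat \<Rightarrow> (nat \<Rightarrow>\<^sub>0 nat)"
  shows "\<exists>\<phi> :: nat \<Rightarrow> nat. strict_mono \<phi> \<and> (\<forall>l<n. mono (\<lambda>i. Poly_Mapping.lookup (g (\<phi> i)) l))"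
proof (induction n)
  case 0
  show ?case by (intro exI[of _ id]) (auto simp: strict_mono_def)
next
  case (Suc n)
  then obtain \<phi> :: "nat \<Rightarrow> nat" where \<phi>: "strict_mono \<phi>" "\<And>l. l < n \<Longrightarrow> mono (\<lambda>i. Poly_Mapping.lookup (g (\<phi> i)) l)" by auto
  obtain \<psi> :: "nat \<Rightarrow> nat" where \<psi>: "strict_mono \<psi>" "mono (\<lambda>i. Poly_Mapping.lookup (g (\<phi> (\<psi> i))) n)"
    using nat_seq_mono_subseq[of "\<lambda>i. Poly_Mapping.lookup (g (\<phi> i)) n"] by auto
  have "mono (\<lambda>i. Poly_Mapping.lookup (g (\<phi> (\<psi> i))) l)" if "l < Suc n" for l
  proof (cases "l = n")
    case False
    then have "mono (\<lambda>i. Poly_Mapping.lookup (g (\<phi> i)) l)" using that \<phi>(2) by simp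
    then show ?thesis using \<psi>(1) by (auto simp: mono_def strict_mono_less_eq)
  qed (use \<psi>(2) in simp)
  then show ?case using \<phi>(1) \<psi>(1) by (intro exI[of _ "\<phi> \<circ> \<psi>"]) (auto simp: strict_mono_def)
qed

text \<open>Along a suitable subsequence each of the finitely many coordinates is weakly increasing.\<close>

lemma dickson:
  fixes g :: "nat \<Rightarrow> (nat \<Rightarrow>\<^sub>0 nat)"
  assumes "\<And>i. Poly_Mapping.keys (g i) \<subseteq> {..<n}"
  obtains i j where "i < j" "\<And>l. Poly_Mapping.lookup (g i) l \<le> Poly_Mapping.lookup (g j) l"
proof -
  obtain \<phi> :: "nat \<Rightarrow> nat" where \<phi>: "strict_mono \<phi>" "\<And>l. l < n \<Longrightarrow> mono (\<lambda>i. Poly_Mapping.lookup (g (\<phi> i)) l)"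
    using exponents_mono_subseq[of n g] by auto
  have "Poly_Mapping.lookup (g (\<phi> 0)) l \<le> Poly_Mapping.lookup (g (\<phi> 1)) l" for l
  proof (cases "l < n")
    case True
    then show ?thesis using monoD[OF \<phi>(2), of l 0 1] by simp
  next
    case False
    then have "l \<notin> Poly_Mapping.keys (g (\<phi> 0))" using assms by auto
    then show ?thesis by (simp add: in_keys_iff)
  qed
  moreover have "\<phi> 0 < \<phi> 1" using \<phi>(1) by (simp add: strict_mono_def)
  ultimately show ?thesis using that by blast
qed

lemma exponents_diff_add:
  fixes a b :: "nat \<Rightarrow>\<^sub>0 nat"
  assumes "\<And>l. Poly_Mapping.lookup a l \<le> Poly_Mapping.lookup b l"
  shows "(b - a) + a = b"
  by (rule poly_mapping_eqI) (use assms in \<open>simp add: lookup_add lookup_minus\<close>)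

lemma exponents_nonneg: "0 \<le> (c :: nat \<Rightarrow>\<^sub>0 nat)"
  by (rule ccontr) (auto simp: not_le less_poly_mapping.rep_eq less_fun_def)

lemma exponents_le_if_dvd:
  fixes a b :: "nat \<Rightarrow>\<^sub>0 nat"
  assumes "\<And>l. Poly_Mapping.lookup a l \<le> Poly_Mapping.lookup b l"
  shows "a \<le> b"
  using add_right_mono[OF exponents_nonneg[of "b - a"], of a] exponents_diff_add[OF assms] by simp

text \<open>The order on exponents is lexicographic and extends divisibility, so by Dickson's lemma it admits
  no infinite descent while the number of variables stays bounded.\<close>

lemma wf_exponents:
  "wf {(a, b :: nat \<Rightarrow>\<^sub>0 nat). a < b \<and> Poly_Mapping.keys a \<subseteq> {..<n} \<and> Poly_Mapping.keys b \<subseteq> {..<n}}"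
  unfolding wf_iff_no_infinite_down_chain
proof
  assume "\<exists>s. \<forall>i. (s (Suc i), s i) \<in> {(a, b :: nat \<Rightarrow>\<^sub>0 nat). a < b \<and> Poly_Mapping.keys a \<subseteq> {..<n} \<and> Poly_Mapping.keys b \<subseteq> {..<n}}"
  then obtain s :: "nat \<Rightarrow> (nat \<Rightarrow>\<^sub>0 nat)" where s: "\<And>i. s (Suc i) < s i" "\<And>i. Poly_Mapping.keys (s i) \<subseteq> {..<n}" by auto
  obtain i j where ij: "i < j" "\<And>l. Poly_Mapping.lookup (s i) l \<le> Poly_Mapping.lookup (s j) l"
    using dickson[of s n] s(2) by metis
  have "s j < s i" using ij(1)
    by (induction rule: less_Suc_induct) (auto intro: s(1) less_trans)
  then show False using exponents_le_if_dvd[OF ij(2)] by simp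
qed

definition lead_exponent :: "'a::comm_ring_1 mpoly \<Rightarrow> (nat \<Rightarrow>\<^sub>0 nat)" where
  "lead_exponent p = Max (Poly_Mapping.keys p)"

lemma lead_exponent_in: "p \<noteq> 0 \<Longrightarrow> lead_exponent p \<in> Poly_Mapping.keys p"
  unfolding lead_exponent_def by (rule Max_in) auto

lemma lead_exponent_ge: "m \<in> Poly_Mapping.keys p \<Longrightarrow> m \<le> lead_exponent p"
  unfolding lead_exponent_def by (rule Max_ge) auto

lemma lookup_single_mult:
  fixes p :: "'a::comm_ring_1 mpoly"
  shows "Poly_Mapping.lookup (Poly_Mapping.single m c * p) (m + k) = c * Poly_Mapping.lookup p k"
  by (induction p rule: mpoly_induct)
     (auto simp: mult_single lookup_single lookup_add distrib_left when_def)

text \<open>One step of polynomial division: the leading terms cancel.\<close>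

lemma reduce_lead_exponent:
  fixes p q :: "'a::field mpoly"
  assumes "p \<noteq> 0" "q \<noteq> 0"
    and dvd: "\<And>l. Poly_Mapping.lookup (lead_exponent q) l \<le> Poly_Mapping.lookup (lead_exponent p) l"
  shows "\<exists>c. \<forall>k\<in>Poly_Mapping.keys (p - Poly_Mapping.single (lead_exponent p - lead_exponent q) c * q). k < lead_exponent p"
proof -
  let ?a = "lead_exponent p" and ?b = "lead_exponent q"
  define c where "c = Poly_Mapping.lookup p ?a / Poly_Mapping.lookup q ?b"
  let ?s = "Poly_Mapping.single (?a - ?b) c * q"
  have ab: "(?a - ?b) + ?b = ?a" using dvd by (rule exponents_diff_add)
  have "k < ?a" if k: "k \<in> Poly_Mapping.keys (p - ?s)" for k
  proof -
    have "k \<in> Poly_Mapping.keys p \<or> k \<in> Poly_Mapping.keys ?s"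
      using k keys_diff[of p ?s] by auto
    then have "k \<le> ?a"
    proof
      assume "k \<in> Poly_Mapping.keys ?s"
      then obtain k' where k': "k = (?a - ?b) + k'" "k' \<in> Poly_Mapping.keys q"
        using keys_mult[of "Poly_Mapping.single (?a - ?b) c" q] by (auto split: if_splits)
      then show ?thesis using add_left_mono[OF lead_exponent_ge[OF k'(2)], of "?a - ?b"] ab by simp
    qed (rule lead_exponent_ge)
    moreover have "Poly_Mapping.lookup (p - ?s) ?a = 0"
      using lookup_single_mult[of "?a - ?b" c q ?b] lead_exponent_in[OF assms(2)]
      unfolding ab by (simp add: lookup_minus c_def in_keys_iff)
    ultimately show ?thesis using k by (auto simp: in_keys_iff less_le)
  qed
  then show ?thesis by blast
qed

text \<open>Hilbert's basis theorem in geometric form. From each step of a descending chain take a function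
  that vanishes on the smaller set only, with least possible leading exponent. By Dickson's lemma
  one leading exponent divides a later one, and the division step then contradicts minimality.\<close>

lemma wf_algebraic_sets:
  "wf {(A, B :: 'k::field vec set). algebraic_set n A \<and> algebraic_set n B \<and> A \<subset> B}"
  unfolding wf_iff_no_infinite_down_chain
proof
  assume "\<exists>s. \<forall>i. (s (Suc i), s i) \<in> {(A, B :: 'k vec set). algebraic_set n A \<and> algebraic_set n B \<and> A \<subset> B}"
  then obtain Z :: "nat \<Rightarrow> 'k vec set"
    where "\<forall>i. (Z (Suc i), Z i) \<in> {(A, B). algebraic_set n A \<and> algebraic_set n B \<and> A \<subset> B}" by blast
  then have Z: "\<And>i. algebraic_set n (Z i)" "\<And>i. Z (Suc i) \<subset> Z i" by simp_all
  have anti: "Z j \<subseteq> Z i" if "i \<le> j" for i j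
    using that by (induction rule: dec_induct) (use Z(2) in auto)
  define D where "D i = {p\<in>mpolys n. (\<forall>x\<in>Z (Suc i). mpoly_eval p x = 0) \<and> (\<exists>x\<in>Z i. mpoly_eval p x \<noteq> 0)}" for i
  have D_ne: "D i \<noteq> {}" for i
  proof -
    have "Z i \<subseteq> carrier_vec n" "\<not> Z i \<subseteq> Z (Suc i)"
      using algebraic_set_carrier[OF Z(1)] Z(2)[of i] by blast+
    from algebraic_set_separate[OF Z(1) this] obtain p where "p \<in> D i" unfolding D_def by blast
    then show ?thesis by blast
  qed
  have wf: "wf (inv_image {(a, b). a < b \<and> Poly_Mapping.keys a \<subseteq> {..<n} \<and> Poly_Mapping.keys b \<subseteq> {..<n}}
      (lead_exponent :: 'k mpoly \<Rightarrow> _))"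
    by (rule wf_inv_image[OF wf_exponents])
  have D0: "p \<noteq> 0" if "p \<in> D i" for p i using that by (auto simp: D_def)
  have keys: "Poly_Mapping.keys (lead_exponent p) \<subseteq> {..<n}" if "p \<in> D i" for p i
    using lead_exponent_in[OF D0[OF that]] that by (auto simp: D_def mpolys_def)
  have "\<exists>p\<in>D i. \<forall>q\<in>D i. \<not> lead_exponent q < lead_exponent p" for i
  proof -
    obtain p0 where p0: "p0 \<in> D i" using D_ne by blast
    from wf[unfolded wf_eq_minimal, rule_format, OF p0]
    obtain p where p: "p \<in> D i" and min: "\<forall>q. (q, p) \<in> inv_image {(a, b). a < b \<and> Poly_Mapping.keys a \<subseteq> {..<n}
        \<and> Poly_Mapping.keys b \<subseteq> {..<n}} lead_exponent \<longrightarrow> q \<notin> D i"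
      by blast
    have "\<not> lead_exponent q < lead_exponent p" if q: "q \<in> D i" for q
      using min[rule_format, of q] keys[OF q] keys[OF p] q by auto
    then show ?thesis using p by blast
  qed
  then have "\<forall>i. \<exists>p. p \<in> D i \<and> (\<forall>q\<in>D i. \<not> lead_exponent q < lead_exponent p)" by blast
  from choice[OF this] obtain p where p: "\<And>i. p i \<in> D i"
    "\<And>i q. q \<in> D i \<Longrightarrow> \<not> lead_exponent q < lead_exponent (p i)" by blast
  have "\<And>i. Poly_Mapping.keys (lead_exponent (p i)) \<subseteq> {..<n}" using keys p(1) by blast
  from dickson[of "\<lambda>i. lead_exponent (p i)", OF this]
  obtain i j where ij: "i < j"
    "\<And>l. Poly_Mapping.lookup (lead_exponent (p i)) l \<le> Poly_Mapping.lookup (lead_exponent (p j)) l"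
    by blast
  let ?m = "lead_exponent (p j) - lead_exponent (p i)"
  obtain c where c: "\<forall>k\<in>Poly_Mapping.keys (p j - Poly_Mapping.single ?m c * p i). k < lead_exponent (p j)"
    using reduce_lead_exponent[OF D0[OF p(1)] D0[OF p(1)] ij(2)] by blast
  let ?r = "p j - Poly_Mapping.single ?m c * p i"
  have "Poly_Mapping.keys ?m \<subseteq> Poly_Mapping.keys (lead_exponent (p j))"
    by (auto simp: in_keys_iff lookup_minus)
  then have "Poly_Mapping.single ?m c \<in> mpolys n" using keys[OF p(1), of j] by (auto simp: mpolys_def)
  then have "?r \<in> mpolys n" using p(1)[of i] p(1)[of j] by (auto simp: D_def mpolys_eq)
  moreover have "mpoly_eval ?r x = mpoly_eval (p j) x" if "x \<in> Z (Suc i)" for x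
    using p(1)[of i] that by (auto simp: D_def mpoly_eval.hom_minus mpoly_eval.hom_mult)
  then have "mpoly_eval ?r x = mpoly_eval (p j) x" if "x \<in> Z j" for x
    using that anti[of "Suc i" j] ij(1) by auto
  then have "(\<forall>x\<in>Z (Suc j). mpoly_eval ?r x = 0) \<and> (\<exists>x\<in>Z j. mpoly_eval ?r x \<noteq> 0)"
    using p(1)[of j] Z(2)[of j] by (auto simp: D_def)
  ultimately have "?r \<in> D j" by (simp add: D_def)
  then show False using p(2)[of ?r j] c lead_exponent_in[OF D0, of ?r j] by blast
qed



section \<open>Hypersurfaces that are finite over a coordinate hyperplane\<close>

lemma poly_fun_eq_imp_eq:
  fixes p q :: "'a::alg_closed_field poly"
  assumes "\<And>b. poly p b = poly q b"
  shows "p = q"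
proof -
  have "{b. poly (p - q) b = 0} = UNIV" using assms by auto
  then show ?thesis using poly_roots_finite[of "p - q"] infinite_UNIV_alg_closed[where ?'a = 'a] by auto
qed

text \<open>The degree of \<open>h\<close> bounds the multiplicities of its roots.\<close>

lemma dvd_power_if_roots_subset:
  fixes h f :: "'a::alg_closed_field poly"
  assumes "h \<noteq> 0" and roots: "\<And>b. poly h b = 0 \<Longrightarrow> poly f b = 0"
  shows "h dvd f ^ degree h"
proof -
  obtain A where A: "size A = degree h" "h = smult (lead_coeff h) (\<Prod>x\<in>#A. [:- x, 1:])"
    using alg_closed_imp_factorization[OF assms(1)] by blast
  have "(\<Prod>x\<in>#B. [:- x, 1:]) dvd f ^ size B" if "B \<subseteq># A" for B
    using that
  proof (induction B)
    case (add x B)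
    have "x \<in># A" using add.prems by (simp add: insert_subset_eq_iff)
    then have "[:- x, 1:] dvd (\<Prod>x\<in>#A. [:- x, 1:])" by (intro dvd_prod_mset) auto
    then have "[:- x, 1:] dvd h" using A(2) by (metis dvd_smult)
    then have "[:- x, 1:] dvd f" using roots by (simp add: poly_eq_0_iff_dvd)
    moreover have "B \<subseteq># A" using add.prems by (metis mset_subset_eq_insertD subset_mset.less_imp_le)
    ultimately have "[:- x, 1:] * (\<Prod>x\<in>#B. [:- x, 1:]) dvd f * f ^ size B"
      using add.IH by (intro mult_dvd_mono)
    then show ?case by (simp only: image_mset_add_mset prod_mset.add_mset size_add_mset power_Suc)
  qed simp
  from this[of A] have "(\<Prod>x\<in>#A. [:- x, 1:]) dvd f ^ degree h" using A(1) by simp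
  then have "smult (lead_coeff h) (\<Prod>x\<in>#A. [:- x, 1:]) dvd f ^ degree h"
    using assms(1) by (intro smult_dvd) auto
  then show ?thesis by (simp only: A(2)[symmetric])
qed

text \<open>The remainder of \<open>Fp ^ d\<close> by \<open>Hp\<close> is compatible with specialisation because \<open>Hp\<close> is monic. It
  is zero wherever \<open>G\<close> is nonzero, so its coefficients, multiplied by \<open>G\<close>, vanish identically.\<close>

lemma monic_dvd_power_if_generic:
  fixes Hp Fp :: "'k::alg_closed_field mpoly poly"
  assumes monic: "lead_coeff Hp = 1" and G: "G \<noteq> 0"
    and roots: "\<And>\<sigma> b. fun_eval \<sigma> G \<noteq> 0 \<Longrightarrow> poly (map_poly (fun_eval \<sigma>) Hp) b = 0 \<Longrightarrow>
                  poly (map_poly (fun_eval \<sigma>) Fp) b = 0"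
  shows "Hp dvd Fp ^ degree Hp"
proof -
  have Hp0: "Hp \<noteq> 0" using monic by auto
  let ?P = "Fp ^ degree Hp"
  obtain q r where qr: "pseudo_divmod ?P Hp = (q, r)" by (cases "pseudo_divmod ?P Hp")
  have P: "?P = Hp * q + r" and r: "r = 0 \<or> degree r < degree Hp"
    using pseudo_divmod[OF Hp0 qr] monic by auto
  have "coeff r e = 0" for e
  proof -
    have "fun_eval \<sigma> (coeff r e * G) = 0" for \<sigma>
    proof (cases "fun_eval \<sigma> G = 0")
      case False
      interpret m: map_poly_comm_ring_hom "fun_eval \<sigma> :: 'k mpoly \<Rightarrow> 'k" ..
      let ?m = "map_poly (fun_eval \<sigma>) :: 'k mpoly poly \<Rightarrow> 'k poly"
      have hd: "coeff (?m Hp) (degree Hp) = 1" using monic by simp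
      have nz: "?m Hp \<noteq> 0"
      proof
        assume "?m Hp = 0"
        with hd show False by (simp only: coeff_0 zero_neq_one)
      qed
      have "degree Hp \<le> degree (?m Hp)" by (rule le_degree) (simp only: hd, simp)
      then have deg: "degree (?m Hp) = degree Hp" by (intro antisym degree_map_poly_le)
      have "?m Hp dvd ?m Fp ^ degree Hp"
        using dvd_power_if_roots_subset[OF nz roots[OF False]] deg by simp
      moreover have "?m Fp ^ degree Hp = ?m Hp * ?m q + ?m r"
        using arg_cong[OF P, of ?m] by (simp add: m.hom_power m.hom_add m.hom_mult)
      ultimately have "?m Hp dvd ?m r" by (metis dvd_add_right_iff dvd_triv_left)
      have "?m r = 0"
      proof (rule ccontr)
        assume nz: "?m r \<noteq> 0"
        then have "degree Hp \<le> degree (?m r)" using dvd_imp_degree_le[OF \<open>?m Hp dvd ?m r\<close>] deg by simp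
        also have "\<dots> \<le> degree r" by (rule degree_map_poly_le)
        finally show False using r nz by auto
      qed
      then have "coeff (?m r) e = 0" by simp
      then show ?thesis by (simp add: fun_eval.hom_mult)
    qed (simp add: fun_eval.hom_mult)
    then have "coeff r e * G = 0" by (rule mpoly_eq_0I[OF infinite_UNIV_alg_closed])
    then show ?thesis using G by simp
  qed
  then have "r = 0" by (simp add: poly_eq_iff)
  then show ?thesis using P by simp
qed

text \<open>Monicity in \<open>X\<^sub>i\<close>, expressed through values because \<open>H\<^sub>f\<close> is known through its values; over an
  infinite field these determine the coefficients.\<close>

definition monic_in :: "nat \<Rightarrow> nat \<Rightarrow> 'k::field mpoly \<Rightarrow> bool" where
  "monic_in i d H \<longleftrightarrow> (\<forall>\<sigma>. \<exists>g. lead_coeff g = 1 \<and> degree g = d \<and> (\<forall>b. fun_eval (\<sigma>(i := b)) H = poly g b))"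

text \<open>Restriction to the coordinate subspace through \<open>x\<close> in which the coordinates of \<open>J\<close> and the \<open>i\<close>-th
  are free, as a polynomial in \<open>X\<^sub>i\<close> over the polynomials in the variables of \<open>J\<close>.\<close>

definition univariate_in :: "nat set \<Rightarrow> nat \<Rightarrow> (nat \<Rightarrow> 'k) \<Rightarrow> 'k::field mpoly \<Rightarrow> 'k mpoly poly" where
  "univariate_in J i x = mpoly_subst (\<lambda>a. [:mpoly_const a:])
     (\<lambda>l. if l = i then [:0, 1:] else if l \<in> J then [:mpoly_var l:] else [:mpoly_const (x l):])"

interpretation const_const_hom: comm_ring_hom "\<lambda>a :: 'k::field. [:mpoly_const a:] :: 'k mpoly poly"
  by unfold_locales (auto simp: mpoly_const_hom.hom_add mpoly_const_hom.hom_mult one_pCons mpoly_const_hom.hom_one)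

interpretation univariate_in: comm_ring_hom "univariate_in J i x :: 'k::field mpoly \<Rightarrow> _"
  unfolding univariate_in_def by (rule const_const_hom.mpoly_subst_hom)

lemma poly_univariate_in:
  fixes p :: "'k::field mpoly"
  shows "poly (map_poly (fun_eval \<sigma>) (univariate_in J i x p)) b
       = fun_eval (\<lambda>l. if l = i then b else if l \<in> J then \<sigma> l else x l) p"
proof -
  interpret m: map_poly_comm_ring_hom "fun_eval \<sigma> :: 'k mpoly \<Rightarrow> 'k" ..
  have "comm_ring_hom (\<lambda>P. poly (map_poly (fun_eval \<sigma>) P) b)"
    by unfold_locales (auto simp: m.hom_add m.hom_mult)
  from hom_mpoly_subst[OF this]
  have "poly (map_poly (fun_eval \<sigma>) (univariate_in J i x p)) b =
    mpoly_subst ((\<lambda>P. poly (map_poly (fun_eval \<sigma>) P) b) \<circ> (\<lambda>a. [:mpoly_const a:]))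
     ((\<lambda>P. poly (map_poly (fun_eval \<sigma>) P) b) \<circ> (\<lambda>l. if l = i then [:0, 1:] else if l \<in> J then [:mpoly_var l:] else [:mpoly_const (x l):])) p"
    unfolding univariate_in_def by blast
  also have "(\<lambda>P. poly (map_poly (fun_eval \<sigma>) P) b) \<circ> (\<lambda>a. [:mpoly_const a:]) = id"
    by (simp add: fun_eq_iff fun_eval.map_poly_pCons_hom)
  also have "(\<lambda>P. poly (map_poly (fun_eval \<sigma>) P) b) \<circ> (\<lambda>l. if l = i then [:0, 1:] else if l \<in> J then [:mpoly_var l:] else [:mpoly_const (x l):])
    = (\<lambda>l. if l = i then b else if l \<in> J then \<sigma> l else x l)"
    by (simp add: fun_eq_iff fun_eval.map_poly_pCons_hom)
  finally show ?thesis .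
qed

text \<open>Over an infinite field the coefficients are determined by their values.\<close>

lemma lead_coeff_univariate_in:
  fixes H :: "'k::alg_closed_field mpoly"
  assumes "monic_in i d H"
  shows "degree (univariate_in J i x H) = d" "lead_coeff (univariate_in J i x H) = 1"
proof -
  let ?P = "univariate_in J i x H"
  have *: "lead_coeff (map_poly (fun_eval \<sigma>) ?P) = 1 \<and> degree (map_poly (fun_eval \<sigma>) ?P) = d" for \<sigma>
  proof -
    let ?\<tau> = "\<lambda>l. if l \<in> J then \<sigma> l else x l"
    obtain g where g: "lead_coeff g = 1" "degree g = d" "\<And>b. fun_eval (?\<tau>(i := b)) H = poly g b"
      using assms unfolding monic_in_def by meson
    have "poly (map_poly (fun_eval \<sigma>) ?P) b = poly g b" for b
      unfolding poly_univariate_in g(3)[symmetric] by (rule arg_cong[of _ _ "\<lambda>s. fun_eval s H"]) auto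
    then have "map_poly (fun_eval \<sigma>) ?P = g" by (rule poly_fun_eq_imp_eq)
    then show ?thesis using g by simp
  qed
  have "coeff ?P e = (if e = d then 1 else 0)" if "e \<ge> d" for e
  proof -
    have "fun_eval \<sigma> (coeff ?P e - (if e = d then 1 else 0)) = 0" for \<sigma>
      using *[of \<sigma>] that coeff_eq_0[of "map_poly (fun_eval \<sigma>) ?P" e] by (auto simp: fun_eval.hom_minus)
    then have "coeff ?P e - (if e = d then 1 else 0) = 0" by (rule mpoly_eq_0I[OF infinite_UNIV_alg_closed])
    then show ?thesis by simp
  qed
  then have c: "coeff ?P d = 1" "\<And>e. e > d \<Longrightarrow> coeff ?P e = 0" by simp_all
  have "degree ?P \<le> d" by (rule degree_le) (use c(2) in blast)
  moreover have "d \<le> degree ?P" by (rule le_degree) (simp add: c(1))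
  ultimately show d: "degree ?P = d" by simp
  show "lead_coeff ?P = 1" using c d by simp
qed

lemma restriction_dvd_power:
  fixes H F G :: "'k::alg_closed_field mpoly"
  assumes H: "monic_in i d H" and G: "G \<noteq> 0" "G \<in> mpolys_in J" "i \<notin> J"
    and GF: "\<And>\<sigma>. fun_eval \<sigma> H = 0 \<Longrightarrow> (\<And>l. l \<notin> J \<Longrightarrow> l \<noteq> i \<Longrightarrow> \<sigma> l = x l) \<Longrightarrow>
               fun_eval \<sigma> G \<noteq> 0 \<Longrightarrow> fun_eval \<sigma> F = 0"
  shows "univariate_in J i x H dvd univariate_in J i x F ^ d"
proof -
  have "univariate_in J i x H dvd univariate_in J i x F ^ degree (univariate_in J i x H)"
  proof (rule monic_dvd_power_if_generic[OF _ G(1)])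
    show "lead_coeff (univariate_in J i x H) = 1" using H by (rule lead_coeff_univariate_in)
    fix \<sigma> b
    assume nz: "fun_eval \<sigma> G \<noteq> 0" and root: "poly (map_poly (fun_eval \<sigma>) (univariate_in J i x H)) b = 0"
    let ?\<tau> = "\<lambda>l. if l = i then b else if l \<in> J then \<sigma> l else x l"
    have "fun_eval ?\<tau> G = fun_eval \<sigma> G" by (rule mpoly_subst_cong[OF G(2)]) (use G(3) in auto)
    then show "poly (map_poly (fun_eval \<sigma>) (univariate_in J i x F)) b = 0"
      using GF[of ?\<tau>] nz root unfolding poly_univariate_in by simp
  qed
  then show ?thesis unfolding lead_coeff_univariate_in(1)[OF H] .
qed

text \<open>The part of the restricted hypersurface where \<open>G\<close> is nonzero is dense in it, for every nonzero
  function \<open>G\<close> on the base: no component lies over a proper closed subset of the base.\<close>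

lemma vanishing_off_hypersurface:
  fixes H F G :: "'k::alg_closed_field mpoly"
  assumes "monic_in i d H" "G \<noteq> 0" "G \<in> mpolys_in J" "i \<notin> J"
    and "\<And>\<sigma>. fun_eval \<sigma> H = 0 \<Longrightarrow> (\<And>l. l \<notin> J \<Longrightarrow> l \<noteq> i \<Longrightarrow> \<sigma> l = x l) \<Longrightarrow>
               fun_eval \<sigma> G \<noteq> 0 \<Longrightarrow> fun_eval \<sigma> F = 0"
    and \<sigma>: "fun_eval \<sigma> H = 0" "\<And>l. l \<notin> J \<Longrightarrow> l \<noteq> i \<Longrightarrow> \<sigma> l = x l"
  shows "fun_eval \<sigma> F = 0"
proof -
  interpret m: map_poly_comm_ring_hom "fun_eval \<sigma> :: 'k mpoly \<Rightarrow> 'k" ..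
  have "univariate_in J i x H dvd univariate_in J i x F ^ d"
    by (rule restriction_dvd_power[OF assms(1-4)]) (rule assms(5))
  then obtain Q where Q: "univariate_in J i x F ^ d = univariate_in J i x H * Q" by (elim dvdE)
  have eq: "poly (map_poly (fun_eval \<sigma>) (univariate_in J i x p)) (\<sigma> i) = fun_eval \<sigma> p" for p
    unfolding poly_univariate_in by (rule arg_cong[of _ _ "\<lambda>s. fun_eval s p"]) (use \<sigma>(2) in auto)
  have "poly (map_poly (fun_eval \<sigma>) (univariate_in J i x F ^ d)) (\<sigma> i) = 0"
    unfolding Q by (simp add: m.hom_mult eq \<sigma>(1))
  then have "fun_eval \<sigma> F ^ d = 0" by (simp add: m.hom_power eq)
  then show ?thesis by (cases "d = 0") auto
qed

text \<open>Here all variables are free and \<open>G = 1\<close>; substituting \<open>X\<^sub>i\<close> for the main variable turns the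
  divisibility of univariate polynomials into one of multivariate polynomials.\<close>

lemma vanishing_on_hypersurface_imp_dvd_power:
  fixes H F :: "'k::alg_closed_field mpoly"
  assumes "monic_in i d H" "\<And>\<sigma>. fun_eval \<sigma> H = 0 \<Longrightarrow> fun_eval \<sigma> F = 0"
  shows "H dvd F ^ d"
proof -
  let ?u = "univariate_in (- {i}) i (\<lambda>_. 0) :: 'k mpoly \<Rightarrow> _"
  have "?u H dvd ?u F ^ d"
    by (rule restriction_dvd_power[OF assms(1), of 1]) (use assms(2) in auto)
  then obtain Q where Q: "?u F ^ d = ?u H * Q" by (elim dvdE)
  have hom: "comm_ring_hom (\<lambda>P :: 'k mpoly poly. poly P (mpoly_var i))" by unfold_locales auto
  have eq: "poly (?u p) (mpoly_var i) = p" for p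
  proof -
    have "poly (?u p) (mpoly_var i) = mpoly_subst ((\<lambda>P. poly P (mpoly_var i)) \<circ> (\<lambda>a. [:mpoly_const a:]))
       ((\<lambda>P. poly P (mpoly_var i)) \<circ> (\<lambda>l. if l = i then [:0, 1:] else if l \<in> - {i} then [:mpoly_var l:] else [:mpoly_const 0:])) p"
      unfolding univariate_in_def by (rule hom_mpoly_subst[OF hom])
    also have "\<dots> = mpoly_subst mpoly_const mpoly_var p"
      by (rule arg_cong2[of _ _ _ _ "\<lambda>h s. mpoly_subst h s p"]) auto
    finally show ?thesis by (simp add: mpoly_subst_const_var)
  qed
  have "F ^ d = H * poly Q (mpoly_var i)"
    using arg_cong[OF Q, of "\<lambda>P. poly P (mpoly_var i)"] by (simp add: eq)
  then show ?thesis by simp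
qed

section \<open>A chain of irreducible varieties through a point of a hypersurface\<close>

text \<open>If \<open>V\<close> were decomposed into components, one of those that contain \<open>W\<close> would not lie in \<open>g = 0\<close>.
  Instead of decomposing, take a minimal closed \<open>Z \<subseteq> V\<close> for which every function \<open>F\<close> with \<open>g F = 0\<close> on \<open>Z\<close> vanishes on
  \<open>W\<close>. If \<open>Z\<close> were the union of two smaller closed sets, then for each of them some \<open>F\<close> would violate the
  condition, and the product of these two would violate it for \<open>Z\<close>.\<close>

lemma extend_irreducible_variety:
  fixes V W :: "'k::field vec set"
  assumes V: "algebraic_set n V" and W: "irreducible_variety n W" and g: "g \<in> mpolys n"
    and dense: "\<And>F. F \<in> mpolys n \<Longrightarrow> \<forall>x\<in>V. mpoly_eval g x * mpoly_eval F x = 0 \<Longrightarrow> \<forall>x\<in>W. mpoly_eval F x = 0"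
  shows "\<exists>Z. irreducible_variety n Z \<and> W \<subseteq> Z \<and> Z \<subseteq> V \<and> (\<exists>z\<in>Z. mpoly_eval g z \<noteq> 0)"
proof -
  \<comment> \<open>the ideal of \<open>Z\<close> contains no \<open>g F\<close> with \<open>F\<close> outside the ideal of \<open>W\<close>\<close>
  define P where "P Z \<longleftrightarrow> (\<forall>F\<in>mpolys n. (\<forall>x\<in>Z. mpoly_eval g x * mpoly_eval F x = 0) \<longrightarrow> (\<forall>x\<in>W. mpoly_eval F x = 0))" for Z
  let ?Q = "{Z. algebraic_set n Z \<and> Z \<subseteq> V \<and> P Z}"
  have "V \<in> ?Q" using V dense by (auto simp: P_def)
  from wf_algebraic_sets[unfolded wf_eq_minimal, rule_format, OF \<open>V \<in> ?Q\<close>]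
  obtain Z where Z: "Z \<in> ?Q"
    and min: "\<forall>Y. (Y, Z) \<in> {(A, B). algebraic_set n A \<and> algebraic_set n B \<and> A \<subset> B} \<longrightarrow> Y \<notin> ?Q"
    by blast
  have irrW: "irreducible_set n W" using W by (simp add: irreducible_variety_iff)
  then obtain w where w: "w \<in> W" by (auto simp: irreducible_set_def)
  obtain S where S: "S \<subseteq> mpolys n" "Z = zero_set n S" using Z by (auto simp: algebraic_set_def)
  \<comment> \<open>the equations of \<open>Z\<close> are among the functions \<open>F\<close> that must vanish on \<open>W\<close>\<close>
  have "W \<subseteq> Z"
  proof
    fix x assume x: "x \<in> W"
    have "mpoly_eval F x = 0" if F: "F \<in> S" for F
    proof -
      have "\<forall>y\<in>Z. mpoly_eval g y * mpoly_eval F y = 0" using F S(2) by (simp add: zero_set_def)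
      then show ?thesis using Z F S(1) x by (auto simp: P_def)
    qed
    moreover have "x \<in> carrier_vec n" using irrW x by (auto simp: irreducible_set_def)
    ultimately show "x \<in> Z" by (simp add: S(2) zero_set_def)
  qed
  moreover have "\<exists>z\<in>Z. mpoly_eval g z \<noteq> 0"
  proof (rule ccontr)
    assume "\<not> ?thesis"
    then have "\<forall>x\<in>Z. mpoly_eval g x * mpoly_eval 1 x = 0" by simp
    moreover have "1 \<in> mpolys n" by (simp add: mpolys_eq)
    ultimately have "\<forall>x\<in>W. mpoly_eval 1 x = (0 :: 'k)" using Z unfolding P_def by blast
    then show False using w by simp
  qed
  moreover have "irreducible_variety n Z"
    unfolding irreducible_variety_def
  proof (intro conjI allI impI)
    show "algebraic_set n Z" "Z \<noteq> {}" using Z w \<open>W \<subseteq> Z\<close> by auto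
    fix A B assume AB: "algebraic_set n A" "algebraic_set n B" "Z = A \<union> B"
    have fail: "\<exists>F\<in>mpolys n. (\<forall>x\<in>Y. mpoly_eval g x * mpoly_eval F x = 0) \<and> (\<exists>x\<in>W. mpoly_eval F x \<noteq> 0)"
      if "algebraic_set n Y" "Y \<subset> Z" for Y
    proof -
      have "Y \<notin> ?Q" by (rule min[rule_format]) (use that Z in auto)
      then show ?thesis using that Z unfolding P_def by blast
    qed
    show "Z = A \<or> Z = B"
    proof (rule ccontr)
      assume "\<not> ?thesis"
      then have "A \<subset> Z" "B \<subset> Z" using AB by auto
      obtain F1 where F1: "F1 \<in> mpolys n" "\<forall>x\<in>A. mpoly_eval g x * mpoly_eval F1 x = 0" "\<exists>x\<in>W. mpoly_eval F1 x \<noteq> 0"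
        using fail[OF AB(1) \<open>A \<subset> Z\<close>] by blast
      obtain F2 where F2: "F2 \<in> mpolys n" "\<forall>x\<in>B. mpoly_eval g x * mpoly_eval F2 x = 0" "\<exists>x\<in>W. mpoly_eval F2 x \<noteq> 0"
        using fail[OF AB(2) \<open>B \<subset> Z\<close>] by blast
      have "\<forall>x\<in>Z. mpoly_eval g x * mpoly_eval (F1 * F2) x = 0"
        using AB(3) F1(2) F2(2) by (auto simp: mpoly_eval.hom_mult)
      moreover have "F1 * F2 \<in> mpolys n" using F1(1) F2(1) by (auto simp: mpolys_eq)
      ultimately have "\<forall>x\<in>W. mpoly_eval (F1 * F2) x = 0"
        using Z unfolding P_def by blast
      then have "\<forall>x\<in>W. mpoly_eval F1 x * mpoly_eval F2 x = 0"
        by (simp only: mpoly_eval.hom_mult)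
      then show False using irrW F1(1,3) F2(1,3) unfolding irreducible_set_def by blast
    qed
  qed
  ultimately show ?thesis using Z by blast
qed

lemma irreducible_variety_point:
  fixes x :: "'k::field vec"
  assumes "x \<in> carrier_vec n"
  shows "irreducible_variety n {x}"
  unfolding irreducible_variety_iff
proof
  let ?S = "(\<lambda>l. mpoly_var l - mpoly_const (x $ l)) ` {..<n}"
  have "?S \<subseteq> mpolys n" by (auto simp: mpolys_eq)
  moreover have "{x} = zero_set n ?S"
    using assms by (auto simp: zero_set_def mpoly_eval.hom_minus)
  ultimately show "algebraic_set n {x}" by (auto simp: algebraic_set_def)
  show "irreducible_set n {x}" using assms by (auto simp: irreducible_set_def)
qed

text \<open>Induction on the set \<open>J\<close> of freed coordinates. When \<open>l\<close> is added, density makes \<open>X\<^sub>l - x\<^sub>l\<close> a function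
  to which the extension lemma applies. It vanishes on the old variety but not on the new one, so the
  inclusion is strict.\<close>

lemma chain_through_point:
  fixes H :: "'k::alg_closed_field mpoly"
  assumes H: "H \<in> mpolys n" "monic_in i d H" and i: "i < n" and x: "x \<in> carrier_vec n" "mpoly_eval H x = 0"
    and J: "finite J" "J \<subseteq> {..<n} - {i}"
  shows "\<exists>C. x \<in> C 0 \<and> C (card J) \<subseteq> {z\<in>carrier_vec n. mpoly_eval H z = 0 \<and> (\<forall>l<n. l \<notin> J \<longrightarrow> l \<noteq> i \<longrightarrow> z $ l = x $ l)} \<and>
           (\<forall>j\<le>card J. irreducible_variety n (C j)) \<and> (\<forall>j<card J. C j \<subset> C (Suc j))"
  using J
proof (induction J rule: finite_induct)
  case empty
  show ?case by (rule exI[of _ "\<lambda>_. {x}"]) (use x irreducible_variety_point in auto)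
next
  case (insert l J)
  let ?V = "\<lambda>J. {z\<in>carrier_vec n. mpoly_eval H z = 0 \<and> (\<forall>l<n. l \<notin> J \<longrightarrow> l \<noteq> i \<longrightarrow> z $ l = x $ l)}"
  let ?J = "insert l J"
  have "J \<subseteq> {..<n} - {i}" using insert.prems by blast
  from insert.IH[OF this] obtain C where C: "x \<in> C 0" "C (card J) \<subseteq> ?V J"
    "\<forall>j\<le>card J. irreducible_variety n (C j)" "\<forall>j<card J. C j \<subset> C (Suc j)"
    by (elim exE conjE)
  let ?W = "C (card J)"
  have l: "l < n" "l \<noteq> i" using insert.prems by auto
  define g :: "'k mpoly" where "g = mpoly_var l - mpoly_const (x $ l)"
  have g: "g \<in> mpolys n" "g \<in> mpolys_in ?J" using l by (auto simp: g_def mpolys_eq)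
  have "fun_eval (\<lambda>_. x $ l + 1) g = 1" by (simp add: g_def fun_eval.hom_minus)
  then have g0: "g \<noteq> 0" by auto
  let ?S = "insert H ((\<lambda>m. mpoly_var m - mpoly_const (x $ m)) ` ({..<n} - ?J - {i}))"
  have "?S \<subseteq> mpolys n" using H(1) by (auto simp: mpolys_eq)
  moreover have "?V ?J = zero_set n ?S"
    by (auto simp: zero_set_def mpoly_eval.hom_minus)
  ultimately have alg: "algebraic_set n (?V ?J)" unfolding algebraic_set_def by blast
  have dense: "\<forall>z\<in>?W. mpoly_eval F z = 0"
    if F: "F \<in> mpolys n" "\<forall>z\<in>?V ?J. mpoly_eval g z * mpoly_eval F z = 0" for F
  proof
    fix w assume "w \<in> ?W"
    then have w: "w \<in> ?V J" using C(2) by blast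
    have ev: "fun_eval \<sigma> p = mpoly_eval p (vec n \<sigma>)" if "p \<in> mpolys n" for p :: "'k mpoly" and \<sigma>
      unfolding mpoly_eval_eq by (rule mpoly_subst_cong[OF that[unfolded mpolys_eq]]) simp
    define \<tau> where "\<tau> m = (if m < n then w $ m else x $ m)" for m
    have w_eq: "w = vec n \<tau>" using w by (auto simp: \<tau>_def)
    have "fun_eval \<tau> F = 0"
    proof (rule vanishing_off_hypersurface[OF H(2) g0 g(2)])
      show "i \<notin> ?J" using insert.prems by auto
      show "fun_eval \<tau> H = 0" using w ev[OF H(1), of \<tau>] unfolding w_eq[symmetric] by simp
      show "\<tau> m = x $ m" if "m \<notin> ?J" "m \<noteq> i" for m using w that by (auto simp: \<tau>_def)
      fix \<sigma> assume \<sigma>: "fun_eval \<sigma> H = 0" "\<And>m. m \<notin> ?J \<Longrightarrow> m \<noteq> i \<Longrightarrow> \<sigma> m = x $ m" "fun_eval \<sigma> g \<noteq> 0"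
      have "vec n \<sigma> \<in> ?V ?J" using \<sigma>(1,2) by (auto simp: ev[OF H(1)])
      then have "mpoly_eval g (vec n \<sigma>) * mpoly_eval F (vec n \<sigma>) = 0" using F(2) by blast
      then show "fun_eval \<sigma> F = 0" using \<sigma>(3) by (simp add: ev F(1) g(1))
    qed
    then show "mpoly_eval F w = 0" using ev[OF F(1), of \<tau>] w_eq by simp
  qed
  have irrW: "irreducible_variety n ?W" using C(3) by simp
  obtain Z where Z: "irreducible_variety n Z" "?W \<subseteq> Z" "Z \<subseteq> ?V ?J" "\<exists>z\<in>Z. mpoly_eval g z \<noteq> 0"
    using extend_irreducible_variety[OF alg irrW g(1) dense] by blast
  have "mpoly_eval g w = 0" if "w \<in> ?W" for w
    using that C(2) insert.hyps(2) l by (auto simp: g_def mpoly_eval.hom_minus)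
  then have "?W \<subset> Z" using Z(2,4) by blast
  then show ?case
    by (intro exI[of _ "\<lambda>j. if j \<le> card J then C j else Z"])
       (use C Z insert.hyps \<open>?W \<subset> Z\<close> in \<open>simp add: less_Suc_eq le_Suc_eq\<close>)
qed



section \<open>Partial derivatives and tangent spaces\<close>

lemma mpoly_pderiv_superset:
  assumes "finite S" "Poly_Mapping.keys p \<subseteq> S"
  shows "mpoly_pderiv j p = (\<Sum>m\<in>S. Poly_Mapping.single (m - Poly_Mapping.single j 1)
       (of_nat (Poly_Mapping.lookup m j) * Poly_Mapping.lookup p m))"
  unfolding mpoly_pderiv_def
  by (rule sum.mono_neutral_left) (use assms in \<open>auto simp: in_keys_iff\<close>)

lemma mpoly_pderiv_add: "mpoly_pderiv j (p + q) = mpoly_pderiv j p + mpoly_pderiv j q"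
proof -
  let ?S = "Poly_Mapping.keys p \<union> Poly_Mapping.keys q"
  have "Poly_Mapping.keys (p + q) \<subseteq> ?S" by (rule keys_add)
  then show ?thesis
    by (simp add: mpoly_pderiv_superset[of ?S] lookup_add distrib_left single_add sum.distrib)
qed

lemma mpoly_pderiv_single:
  "mpoly_pderiv j (Poly_Mapping.single m a) =
     Poly_Mapping.single (m - Poly_Mapping.single j 1) (of_nat (Poly_Mapping.lookup m j) * a)"
  by (simp add: mpoly_pderiv_def)

lemma monom_eval_split:
  "monom_eval \<sigma> m = \<sigma> i ^ Poly_Mapping.lookup m i * (\<Prod>j\<in>Poly_Mapping.keys m - {i}. \<sigma> j ^ Poly_Mapping.lookup m j)"
proof -
  let ?S = "insert i (Poly_Mapping.keys m)"
  have "monom_eval \<sigma> m = (\<Prod>j\<in>?S. \<sigma> j ^ Poly_Mapping.lookup m j)"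
    by (rule monom_eval_superset) auto
  also have "\<dots> = \<sigma> i ^ Poly_Mapping.lookup m i * (\<Prod>j\<in>?S - {i}. \<sigma> j ^ Poly_Mapping.lookup m j)"
    by (rule prod.remove) auto
  also have "?S - {i} = Poly_Mapping.keys m - {i}" by auto
  finally show ?thesis .
qed

lemma power_taylor:
  fixes a h :: "'a::comm_ring_1"
  shows "\<exists>r. (a + h) ^ e = a ^ e + h * (of_nat e * a ^ (e - 1)) + h\<^sup>2 * r"
proof (induction e)
  case 0
  show ?case by (intro exI[of _ 0]) simp
next
  case (Suc e)
  then obtain r where r: "(a + h) ^ e = a ^ e + h * (of_nat e * a ^ (e - 1)) + h\<^sup>2 * r" by blast
  have e: "of_nat e * a ^ (e - 1) * a = of_nat e * a ^ e" by (cases e) simp_all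
  have "(a + h) ^ Suc e = (a + h) * (a ^ e + h * (of_nat e * a ^ (e - 1)) + h\<^sup>2 * r)" by (simp add: r)
  also have "\<dots> = a ^ Suc e + h * (of_nat e * a ^ (e - 1) * a + a ^ e) + h\<^sup>2 * (of_nat e * a ^ (e - 1) + (a + h) * r)"
    by (simp add: algebra_simps power2_eq_square)
  also have "of_nat e * a ^ (e - 1) * a + a ^ e = of_nat (Suc e) * a ^ (Suc e - 1)"
    unfolding e by (simp add: algebra_simps)
  finally show ?case by blast
qed

text \<open>The Taylor expansion to first order, in an arbitrary ring of coefficients; it links
  the formal partial derivatives to the behaviour of a polynomial along curves.\<close>

lemma (in comm_ring_hom) mpoly_subst_taylor:
  "\<exists>r. mpoly_subst hom (\<sigma>(i := \<sigma> i + h)) p =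
       mpoly_subst hom \<sigma> p + h * mpoly_subst hom \<sigma> (mpoly_pderiv i p) + h\<^sup>2 * r"
proof (induction p rule: mpoly_induct)
  case zero
  show ?case by (intro exI[of _ 0]) (simp add: mpoly_pderiv_def)
next
  case (single m a)
  let ?e = "Poly_Mapping.lookup m i"
  let ?R = "\<Prod>j\<in>Poly_Mapping.keys m - {i}. \<sigma> j ^ Poly_Mapping.lookup m j"
  obtain r where r: "(\<sigma> i + h) ^ ?e = \<sigma> i ^ ?e + h * (of_nat ?e * \<sigma> i ^ (?e - 1)) + h\<^sup>2 * r"
    using power_taylor by blast
  have "(\<Prod>j\<in>Poly_Mapping.keys m - {i}. (\<sigma>(i := \<sigma> i + h)) j ^ Poly_Mapping.lookup m j) = ?R"
    by (rule prod.cong) auto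
  then have 1: "monom_eval (\<sigma>(i := \<sigma> i + h)) m = (\<sigma> i + h) ^ ?e * ?R"
    unfolding monom_eval_split[of "\<sigma>(i := \<sigma> i + h)" m i] by (simp only: fun_upd_same)
  have 2: "monom_eval \<sigma> (m - Poly_Mapping.single i 1) = \<sigma> i ^ (?e - 1) * ?R"
  proof -
    have "Poly_Mapping.keys (m - Poly_Mapping.single i 1) - {i} = Poly_Mapping.keys m - {i}"
      by (auto simp: in_keys_iff lookup_minus lookup_single when_def)
    then show ?thesis unfolding monom_eval_split[of \<sigma> "m - Poly_Mapping.single i 1" i]
      by (auto simp: lookup_minus lookup_single when_def intro!: arg_cong2[of _ _ _ _ "(*)"] prod.cong)
  qed
  have "mpoly_subst hom (\<sigma>(i := \<sigma> i + h)) (Poly_Mapping.single m a) =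
        mpoly_subst hom \<sigma> (Poly_Mapping.single m a) +
        h * mpoly_subst hom \<sigma> (mpoly_pderiv i (Poly_Mapping.single m a)) + h\<^sup>2 * (hom a * r * ?R)"
    unfolding mpoly_pderiv_single mpoly_subst_single 1 2 monom_eval_split[of \<sigma> m i] r
    by (simp add: hom_mult hom_of_nat algebra_simps)
  then show ?case by blast
next
  case (add p q)
  then obtain r s where rs:
    "mpoly_subst hom (\<sigma>(i := \<sigma> i + h)) p = mpoly_subst hom \<sigma> p + h * mpoly_subst hom \<sigma> (mpoly_pderiv i p) + h\<^sup>2 * r"
    "mpoly_subst hom (\<sigma>(i := \<sigma> i + h)) q = mpoly_subst hom \<sigma> q + h * mpoly_subst hom \<sigma> (mpoly_pderiv i q) + h\<^sup>2 * s"
    by blast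
  then show ?case
    unfolding mpoly_subst_add mpoly_pderiv_add rs
    by (intro exI[of _ "r + s"]) (simp add: algebra_simps)
qed

definition curve_eval :: "(nat \<Rightarrow> 'a poly) \<Rightarrow> 'a::comm_ring_1 mpoly \<Rightarrow> 'a poly" where
  "curve_eval \<gamma> = mpoly_subst (\<lambda>a. [:a:]) \<gamma>"

interpretation poly_const_hom: comm_ring_hom "\<lambda>a :: 'a::comm_ring_1. [:a:]"
  by unfold_locales (auto simp: one_pCons)

interpretation curve_eval: comm_ring_hom "curve_eval \<gamma> :: 'a::comm_ring_1 mpoly \<Rightarrow> 'a poly"
  unfolding curve_eval_def by (rule poly_const_hom.mpoly_subst_hom)

lemma coeff_0_curve_eval:
  assumes "\<And>m. coeff (\<gamma> m) 0 = x m"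
  shows "coeff (curve_eval \<gamma> p) 0 = fun_eval x p"
proof -
  have hom: "comm_ring_hom (\<lambda>P :: 'a poly. coeff P 0)"
    by unfold_locales (auto simp: coeff_mult)
  have "coeff (curve_eval \<gamma> p) 0 = mpoly_subst ((\<lambda>P. coeff P 0) \<circ> (\<lambda>a. [:a:])) ((\<lambda>P. coeff P 0) \<circ> \<gamma>) p"
    unfolding curve_eval_def by (rule hom_mpoly_subst[OF hom])
  also have "\<dots> = fun_eval x p"
    by (rule arg_cong2[of _ _ _ _ "\<lambda>h s. mpoly_subst h s p"]) (use assms in \<open>auto simp: fun_eq_iff\<close>)
  finally show ?thesis .
qed

lemma coeff_1_mult: "coeff (P * Q) 1 = coeff P 0 * coeff Q 1 + coeff P 1 * coeff Q (0::nat)"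
  by (simp add: coeff_mult)

lemma coeff_1_step:
  fixes \<gamma> :: "nat \<Rightarrow> 'a::comm_ring_1 poly"
  assumes h: "coeff h 0 = 0" and \<gamma>: "\<And>m. coeff (\<gamma> m) 0 = x m"
  shows "coeff (curve_eval (\<gamma>(i := \<gamma> i + h)) p) 1 =
         coeff (curve_eval \<gamma> p) 1 + coeff h 1 * fun_eval x (mpoly_pderiv i p)"
proof -
  obtain r where r: "curve_eval (\<gamma>(i := \<gamma> i + h)) p =
      curve_eval \<gamma> p + h * curve_eval \<gamma> (mpoly_pderiv i p) + h\<^sup>2 * r"
    using poly_const_hom.mpoly_subst_taylor[of \<gamma> i h p] unfolding curve_eval_def by blast
  show ?thesis unfolding r
    by (simp add: coeff_1_mult[unfolded One_nat_def] coeff_mult power2_eq_square h coeff_0_curve_eval[OF \<gamma>])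
qed

lemma coeff_1_const_curve: "coeff (curve_eval (\<lambda>m. [:x m:]) p) 1 = 0"
proof -
  have "curve_eval (\<lambda>m. [:x m:]) p = [:fun_eval x p:]"
    using hom_mpoly_subst[OF poly_const_hom.comm_ring_hom_axioms, of id x p]
    by (simp add: curve_eval_def o_def)
  then show ?thesis by simp
qed

text \<open>The chain rule for a curve that moves only two coordinates.\<close>

lemma coeff_1_curve_eval:
  fixes \<gamma> :: "nat \<Rightarrow> 'a::comm_ring_1 poly"
  assumes "i \<noteq> l" and \<gamma>: "\<And>m. coeff (\<gamma> m) 0 = x m" "\<And>m. m \<noteq> i \<Longrightarrow> m \<noteq> l \<Longrightarrow> \<gamma> m = [:x m:]"
  shows "coeff (curve_eval \<gamma> p) 1 =
    coeff (\<gamma> i) 1 * fun_eval x (mpoly_pderiv i p) + coeff (\<gamma> l) 1 * fun_eval x (mpoly_pderiv l p)"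
proof -
  let ?c = "\<lambda>m. [:x m:]"
  let ?c1 = "?c(l := ?c l + (\<gamma> l - [:x l:]))"
  let ?c2 = "?c1(i := ?c1 i + (\<gamma> i - [:x i:]))"
  have "?c2 = \<gamma>" using assms by (auto simp: fun_eq_iff)
  then have "coeff (curve_eval \<gamma> p) 1 = coeff (curve_eval ?c2 p) 1" by simp
  also have "\<dots> = coeff (curve_eval ?c1 p) 1 + coeff (\<gamma> i - [:x i:]) 1 * fun_eval x (mpoly_pderiv i p)"
    by (rule coeff_1_step) (use \<gamma>(1) in auto)
  also have "coeff (curve_eval ?c1 p) 1 =
      coeff (curve_eval ?c p) 1 + coeff (\<gamma> l - [:x l:]) 1 * fun_eval x (mpoly_pderiv l p)"
    by (rule coeff_1_step) (use \<gamma>(1) in auto)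
  finally show ?thesis by (simp add: coeff_1_const_curve[unfolded One_nat_def] id_def)
qed

text \<open>Newton iteration: since \<open>a \<noteq> 0\<close>, the coefficient of \<open>s\<^sup>N\<close> in \<open>H(\<gamma>(s))\<close> can be cancelled by adding
  a multiple of \<open>s\<^sup>N\<close> to the \<open>i\<close>-th coordinate. The velocity \<open>(b, a)\<close> in the plane of \<open>i\<close> and \<open>l\<close> is tangent to
  the hypersurface, which starts the iteration at \<open>N = 2\<close>.\<close>

lemma curve_on_hypersurface:
  fixes H :: "'k::field mpoly"
  assumes il: "i \<noteq> l" and Hx: "fun_eval x H = 0" and a: "a = fun_eval x (mpoly_pderiv i H)" "a \<noteq> 0"
    and b: "b = - fun_eval x (mpoly_pderiv l H)" and N: "N \<ge> 2"
  shows "\<exists>\<gamma>. (\<forall>m. coeff (\<gamma> m) 0 = x m) \<and> (\<forall>m. m \<noteq> i \<longrightarrow> m \<noteq> l \<longrightarrow> \<gamma> m = [:x m:]) \<and>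
     coeff (\<gamma> i) 1 = b \<and> coeff (\<gamma> l) 1 = a \<and> (\<forall>k<N. coeff (curve_eval \<gamma> H) k = 0)"
  using N
proof (induction N rule: dec_induct)
  case base
  define \<gamma> where "\<gamma> m = (if m = i then [:x i, b:] else if m = l then [:x l, a:] else [:x m:])" for m
  have \<gamma>: "\<And>m. coeff (\<gamma> m) 0 = x m" "\<And>m. m \<noteq> i \<Longrightarrow> m \<noteq> l \<Longrightarrow> \<gamma> m = [:x m:]"
    "coeff (\<gamma> i) 1 = b" "coeff (\<gamma> l) 1 = a"
    using il by (auto simp: \<gamma>_def)
  have "coeff (curve_eval \<gamma> H) k = 0" if "k < 2" for k
  proof -
    consider "k = 0" | "k = 1" using \<open>k < 2\<close> by linarith
    then show ?thesis
    proof cases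
      case 1
      then show ?thesis using coeff_0_curve_eval[OF \<gamma>(1)] Hx by simp
    next
      case 2
      have "coeff (curve_eval \<gamma> H) 1 = b * fun_eval x (mpoly_pderiv i H) + a * fun_eval x (mpoly_pderiv l H)"
        using coeff_1_curve_eval[OF il \<gamma>(1,2)] \<gamma>(3,4) by simp
      then show ?thesis unfolding 2 by (simp add: a(1) b)
    qed
  qed
  then show ?case using \<gamma> by blast
next
  case (step N)
  then obtain \<gamma> where \<gamma>: "\<forall>m. coeff (\<gamma> m) 0 = x m" "\<forall>m. m \<noteq> i \<longrightarrow> m \<noteq> l \<longrightarrow> \<gamma> m = [:x m:]"
    "coeff (\<gamma> i) 1 = b" "coeff (\<gamma> l) 1 = a" "\<forall>k<N. coeff (curve_eval \<gamma> H) k = 0"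
    by blast
  \<comment> \<open>the correction \<open>c s\<^sup>N\<close> changes the coefficient of \<open>s\<^sup>N\<close> by \<open>c a\<close> and no lower one\<close>
  define c where "c = - coeff (curve_eval \<gamma> H) N / a"
  define h where "h = monom c N"
  define \<gamma>' where "\<gamma>' = \<gamma>(i := \<gamma> i + h)"
  obtain r where r: "curve_eval \<gamma>' H = curve_eval \<gamma> H + h * curve_eval \<gamma> (mpoly_pderiv i H) + h\<^sup>2 * r"
    using poly_const_hom.mpoly_subst_taylor[of \<gamma> i h H] unfolding curve_eval_def \<gamma>'_def by blast
  have "coeff (curve_eval \<gamma>' H) k = 0" if k: "k < Suc N" for k
  proof -
    have "coeff (h\<^sup>2 * r) k = 0"
      unfolding h_def monom_power coeff_monom_mult using k step.hyps by simp
    moreover have "coeff (curve_eval \<gamma> H) k + coeff (h * curve_eval \<gamma> (mpoly_pderiv i H)) k = 0"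
    proof (cases "k = N")
      case True
      then show ?thesis unfolding h_def coeff_monom_mult
        using coeff_0_curve_eval[of \<gamma> x "mpoly_pderiv i H"] \<gamma>(1) a by (simp add: c_def)
    next
      case False
      then show ?thesis unfolding h_def coeff_monom_mult using k \<gamma>(5) by simp
    qed
    ultimately show ?thesis unfolding r by simp
  qed
  moreover have "\<forall>m. coeff (\<gamma>' m) 0 = x m" "\<forall>m. m \<noteq> i \<longrightarrow> m \<noteq> l \<longrightarrow> \<gamma>' m = [:x m:]"
    "coeff (\<gamma>' i) 1 = b" "coeff (\<gamma>' l) 1 = a"
    using \<gamma>(1-4) il step.hyps by (auto simp: \<gamma>'_def h_def)
  ultimately show ?case by blast
qed

text \<open>On a curve that meets \<open>H = 0\<close> to order greater than \<open>d\<close>, the power \<open>F\<^sup>d\<close> vanishes to that order too, hence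
  \<open>F\<close> to order at least \<open>2\<close>. So the gradient of \<open>F\<close> kills every vector \<open>a e\<^sub>l + b e\<^sub>i\<close> killed by that of \<open>H\<close>.\<close>

lemma gradient_proportional:
  fixes H F :: "'k::field mpoly"
  assumes dvd: "H dvd F ^ d" and Hx: "fun_eval x H = 0" and a0: "fun_eval x (mpoly_pderiv i H) \<noteq> 0"
  shows "fun_eval x (mpoly_pderiv l F) * fun_eval x (mpoly_pderiv i H) =
         fun_eval x (mpoly_pderiv i F) * fun_eval x (mpoly_pderiv l H)"
proof (cases "i = l")
  case False
  obtain U where U: "F ^ d = H * U" using dvd by (elim dvdE)
  have "fun_eval x F ^ d = fun_eval x (H * U)" unfolding U[symmetric] by (simp add: fun_eval.hom_power)
  then have "fun_eval x F ^ d = 0" by (simp add: fun_eval.hom_mult Hx)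
  then have Fx: "fun_eval x F = 0" by (cases "d = 0") auto
  obtain \<gamma> where \<gamma>: "\<forall>m. coeff (\<gamma> m) 0 = x m" "\<forall>m. m \<noteq> i \<longrightarrow> m \<noteq> l \<longrightarrow> \<gamma> m = [:x m:]"
    "coeff (\<gamma> i) 1 = - fun_eval x (mpoly_pderiv l H)" "coeff (\<gamma> l) 1 = fun_eval x (mpoly_pderiv i H)"
    "\<forall>k<d + 2. coeff (curve_eval \<gamma> H) k = 0"
    using curve_on_hypersurface[OF False Hx refl a0 refl, of "d + 2"] by auto
  let ?P = "curve_eval \<gamma> F"
  have P0: "coeff ?P 0 = 0" using coeff_0_curve_eval[of \<gamma> x F] \<gamma>(1) Fx by simp
  obtain c q where P: "?P = pCons c q" by (cases ?P)
  have Pq: "?P = monom 1 1 * q" using P P0 by (simp add: monom_altdef)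
  have "coeff (?P ^ d) d = coeff q 0 ^ d"
    unfolding Pq power_mult_distrib monom_power by (simp add: coeff_monom_mult coeff_0_power)
  moreover have "?P ^ d = curve_eval \<gamma> H * curve_eval \<gamma> U"
    using arg_cong[OF U, of "curve_eval \<gamma>"] by (simp add: curve_eval.hom_power curve_eval.hom_mult)
  moreover have "coeff (curve_eval \<gamma> H * curve_eval \<gamma> U) d = 0"
    unfolding coeff_mult using \<gamma>(5) by (intro sum.neutral) auto
  ultimately have "coeff q 0 ^ d = 0" by simp
  then have "coeff ?P 1 = 0" unfolding P by (cases "d = 0") auto
  then have "coeff (\<gamma> i) 1 * fun_eval x (mpoly_pderiv i F) + coeff (\<gamma> l) 1 * fun_eval x (mpoly_pderiv l F) = 0"
    using coeff_1_curve_eval[OF False, of \<gamma> x F] \<gamma>(1,2) by simp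
  then show ?thesis unfolding \<gamma>(3,4) by (simp add: algebra_simps)
qed simp

text \<open>The kernel is that of the single row \<open>w\<close>, which becomes an echelon form after division by its
  first nonzero entry.\<close>

lemma kernel_dim_rank_one:
  fixes w :: "nat \<Rightarrow> 'k::field"
  assumes j: "j < r" "\<mu> j \<noteq> 0" and i: "i < n" "w i \<noteq> 0"
  shows "kernel_dim (mat r n (\<lambda>(j, l). \<mu> j * w l)) = n - 1"
proof -
  let ?A = "mat r n (\<lambda>(j, l). \<mu> j * w l)"
  define p where "p = (LEAST l. w l \<noteq> 0)"
  have p: "w p \<noteq> 0" unfolding p_def using i(2) by (rule LeastI)
  have p_le: "p \<le> i" unfolding p_def using i(2) by (rule Least_le)
  have before: "w l = 0" if "l < p" for l using not_less_Least[of l "\<lambda>l. w l \<noteq> 0"] that unfolding p_def by auto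
  define B where "B = mat 1 n (\<lambda>(j, l). w l / w p)"
  have A: "?A \<in> carrier_mat r n" and B: "B \<in> carrier_mat 1 n" by (auto simp: B_def)
  have Av: "(?A *\<^sub>v v) $ j = \<mu> j * (\<Sum>l<n. w l * v $ l)" if "j < r" "v \<in> carrier_vec n" for v j
    using that by (simp add: scalar_prod_def sum_distrib_left mult.assoc atLeast0LessThan)
  have Bv: "(B *\<^sub>v v) $ 0 = (\<Sum>l<n. w l * v $ l) / w p" if "v \<in> carrier_vec n" for v
    using that by (simp add: B_def scalar_prod_def sum_divide_distrib atLeast0LessThan)
  have "mat_kernel ?A = {v\<in>carrier_vec n. (\<Sum>l<n. w l * v $ l) = 0}"
  proof -
    have "?A *\<^sub>v v = 0\<^sub>v r \<longleftrightarrow> (\<Sum>l<n. w l * v $ l) = 0" if v: "v \<in> carrier_vec n" for v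
    proof
      assume "?A *\<^sub>v v = 0\<^sub>v r"
      then have "(?A *\<^sub>v v) $ j = 0" using j(1) by simp
      then show "(\<Sum>l<n. w l * v $ l) = 0" using Av[OF j(1) v] j(2) by simp
    next
      assume "(\<Sum>l<n. w l * v $ l) = 0"
      then show "?A *\<^sub>v v = 0\<^sub>v r" using Av[OF _ v] by (intro eq_vecI) auto
    qed
    then show ?thesis unfolding mat_kernel[OF A] by blast
  qed
  moreover have "mat_kernel B = {v\<in>carrier_vec n. (\<Sum>l<n. w l * v $ l) = 0}"
  proof -
    have "B *\<^sub>v v = 0\<^sub>v 1 \<longleftrightarrow> (\<Sum>l<n. w l * v $ l) = 0" if v: "v \<in> carrier_vec n" for v
    proof
      assume "B *\<^sub>v v = 0\<^sub>v 1"
      then have "(B *\<^sub>v v) $ 0 = 0" by simp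
      then show "(\<Sum>l<n. w l * v $ l) = 0" using Bv[OF v] p by simp
    next
      assume "(\<Sum>l<n. w l * v $ l) = 0"
      then show "B *\<^sub>v v = 0\<^sub>v 1" using Bv[OF v] B by (intro eq_vecI) auto
    qed
    then show ?thesis unfolding mat_kernel[OF B] by blast
  qed
  ultimately have same: "mat_kernel ?A = mat_kernel B" by simp
  have "pivot_fun B (\<lambda>_. p) n"
    by (rule pivot_funI[of _ 1]) (use p p_le i(1) before in \<open>auto simp: B_def\<close>)
  then have ref: "row_echelon_form B" unfolding row_echelon_form_def using B by auto
  have "row B 0 $ p \<noteq> 0" using p p_le i(1) by (simp add: B_def)
  then have "row B 0 \<noteq> 0\<^sub>v n" using p_le i(1) by auto
  then have "{j. j < 1 \<and> row B j \<noteq> 0\<^sub>v n} = {0}" by auto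
  then have "kernel.dim n B = n - 1" using find_base_vectors(6)[OF ref B] by simp
  then show ?thesis unfolding kernel_dim_def same using A by simp
qed

lemma vanishing_ideal_generator:
  assumes "ideal_generated n Fs = vanishing_ideal n V" "j < length Fs"
  shows "Fs ! j \<in> vanishing_ideal n V"
proof -
  have "Fs ! j = (\<Sum>m<length Fs. (if m = j then 1 else 0) * Fs ! m)"
    using assms(2) by (simp add: if_distrib[of "\<lambda>c. c * _"] cong: if_cong)
  moreover have "\<forall>m. (if m = j then 1 else 0) \<in> mpolys n" by (auto simp: mpolys_eq)
  ultimately have "Fs ! j \<in> ideal_generated n Fs" unfolding ideal_generated_def
    by (intro CollectI exI[of _ "\<lambda>m. if m = j then 1 else 0"] conjI)
  then show ?thesis using assms(1) by simp
qed

lemma fun_eval_vec: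
  assumes "p \<in> mpolys n"
  shows "fun_eval \<sigma> p = mpoly_eval p (vec n \<sigma>)"
  unfolding mpoly_eval_eq by (rule mpoly_subst_cong[OF assms[unfolded mpolys_eq]]) simp

text \<open>All rows of the Jacobian are multiples of the gradient of \<open>H\<close>. Not all of them are zero, since \<open>H\<close> is
  itself a combination of the generators and these vanish at \<open>x\<close>.\<close>

lemma kernel_dim_jacobian_hypersurface:
  fixes H :: "'k::alg_closed_field mpoly"
  assumes H: "H \<in> mpolys n" "monic_in i d H" and i: "i < n"
    and x: "x \<in> zero_set n {H}" and smooth: "mpoly_eval (mpoly_pderiv i H) x \<noteq> 0"
    and Fs: "ideal_generated n Fs = vanishing_ideal n (zero_set n {H})"
  shows "kernel_dim (jacobian n Fs x) = n - 1"
proof -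
  let ?V = "zero_set n {H}"
  define w where "w l = mpoly_eval (mpoly_pderiv l H) x" for l
  define u where "u j = mpoly_eval (mpoly_pderiv i (Fs ! j)) x / w i" for j
  have wi: "w i \<noteq> 0" using smooth by (simp add: w_def)
  have gradF: "mpoly_eval (mpoly_pderiv l (Fs ! j)) x = u j * w l" if j: "j < length Fs" for j l
  proof -
    have F: "Fs ! j \<in> mpolys n" "\<forall>z\<in>?V. mpoly_eval (Fs ! j) z = 0"
      using vanishing_ideal_generator[OF Fs j] by (auto simp: vanishing_ideal_def)
    have "H dvd (Fs ! j) ^ d"
    proof (rule vanishing_on_hypersurface_imp_dvd_power[OF H(2)])
      fix \<sigma> assume "fun_eval \<sigma> H = 0"
      then have "vec n \<sigma> \<in> ?V" unfolding fun_eval_vec[OF H(1)] by (simp add: zero_set_def)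
      then show "fun_eval \<sigma> (Fs ! j) = 0" unfolding fun_eval_vec[OF F(1)] using F(2) by blast
    qed
    from gradient_proportional[OF this, of "vec_index x" i l, folded mpoly_eval_eq]
    have "mpoly_eval (mpoly_pderiv l (Fs ! j)) x * w i = mpoly_eval (mpoly_pderiv i (Fs ! j)) x * w l"
      using x smooth by (simp add: zero_set_def w_def)
    then show ?thesis using wi by (simp add: u_def nonzero_eq_divide_eq)
  qed
  have "\<exists>j<length Fs. u j \<noteq> 0"
  proof (rule ccontr)
    assume "\<not> ?thesis"
    then have z: "mpoly_eval (mpoly_pderiv i (Fs ! j)) x = 0" if "j < length Fs" for j
      using that wi by (auto simp: u_def)
    have "H \<in> ideal_generated n Fs" unfolding Fs using H(1) by (auto simp: vanishing_ideal_def zero_set_def)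
    then obtain G where G: "H = (\<Sum>j<length Fs. G j * Fs ! j)" unfolding ideal_generated_def by blast
    define \<gamma> where "\<gamma> m = (if m = i then [:x $ i, 1:] else [:x $ m:])" for m
    have \<gamma>: "\<And>m. coeff (\<gamma> m) 0 = x $ m" by (simp add: \<gamma>_def)
    have D: "coeff (curve_eval \<gamma> p) 1 = mpoly_eval (mpoly_pderiv i p) x" for p
      using coeff_1_curve_eval[of i "Suc i" \<gamma> "vec_index x" p] \<gamma>
      by (simp add: \<gamma>_def flip: mpoly_eval_eq)
    have "mpoly_eval (mpoly_pderiv i H) x = (\<Sum>j<length Fs. coeff (curve_eval \<gamma> (G j) * curve_eval \<gamma> (Fs ! j)) 1)"
      unfolding D[symmetric] by (subst G) (simp add: curve_eval.hom_sum curve_eval.hom_mult coeff_sum)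
    also have "\<dots> = 0"
    proof (rule sum.neutral, intro ballI)
      fix j assume "j \<in> {..<length Fs}"
      then have j: "j < length Fs" by simp
      have "mpoly_eval (Fs ! j) x = 0"
        using vanishing_ideal_generator[OF Fs j] x by (auto simp: vanishing_ideal_def)
      then have "coeff (curve_eval \<gamma> (Fs ! j)) 0 = 0"
        using coeff_0_curve_eval[of \<gamma> "vec_index x" "Fs ! j"] \<gamma> by (simp add: mpoly_eval_eq)
      then show "coeff (curve_eval \<gamma> (G j) * curve_eval \<gamma> (Fs ! j)) 1 = 0"
        unfolding coeff_1_mult D z[OF j] by simp
    qed
    finally show False using smooth by simp
  qed
  then obtain j where j: "j < length Fs" "u j \<noteq> 0" by blast
  have "jacobian n Fs x = mat (length Fs) n (\<lambda>(j, l). u j * w l)"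
    unfolding jacobian_def by (rule eq_matI) (auto simp: gradF)
  then show ?thesis using kernel_dim_rank_one[of j "length Fs" u i n w] j i wi by simp
qed

section \<open>Smooth points of hypersurfaces\<close>

lemma irreducible_set_carrier_vec: "irreducible_set n (carrier_vec n :: 'k::alg_closed_field vec set)"
  unfolding irreducible_set_def
proof (intro conjI ballI impI)
  show "carrier_vec n \<noteq> ({} :: 'k vec set)" using zero_carrier_vec by blast
  fix p q :: "'k mpoly"
  assume pq: "p \<in> mpolys n" "q \<in> mpolys n" "\<forall>x\<in>carrier_vec n. mpoly_eval p x * mpoly_eval q x = 0"
  have "fun_eval \<sigma> (p * q) = 0" for \<sigma>
    using pq(3) by (simp add: fun_eval.hom_mult fun_eval_vec[OF pq(1)] fun_eval_vec[OF pq(2)])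
  then have "p * q = 0" by (rule mpoly_eq_0I[OF infinite_UNIV_alg_closed])
  then have "p = 0 \<or> q = 0" by simp
  then show "(\<forall>x\<in>carrier_vec n. mpoly_eval p x = 0) \<or> (\<forall>x\<in>carrier_vec n. mpoly_eval q x = 0)" by auto
qed simp

lemma chain_mono:
  fixes C :: "nat \<Rightarrow> 'a set"
  assumes "\<And>j. j < r \<Longrightarrow> C j \<subset> C (Suc j)" "i \<le> r"
  shows "C i \<subseteq> C r"
  using assms(2)
proof (induction rule: inc_induct)
  case (step m)
  then show ?case using assms(1)[of m] by blast
qed simp

text \<open>Affine space can be put on top of the chain, since \<open>H\<close> does not vanish everywhere.\<close>

lemma chain_in_hypersurface:
  fixes H :: "'k::alg_closed_field mpoly" and C :: "nat \<Rightarrow> 'k vec set"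
  assumes H: "H \<in> mpolys n" "monic_in i d H"
    and C: "\<And>j. j \<le> r \<Longrightarrow> irreducible_variety n (C j)" "\<And>j. j < r \<Longrightarrow> C j \<subset> C (Suc j)"
      "C r \<subseteq> zero_set n {H}"
  shows "Suc r \<le> n"
proof -
  define C' where "C' j = (if j \<le> r then C j else carrier_vec n)" for j
  have "\<exists>z\<in>carrier_vec n. mpoly_eval H z \<noteq> 0"
  proof (rule ccontr)
    assume "\<not> ?thesis"
    then have z: "fun_eval \<sigma> H = 0" for \<sigma> unfolding fun_eval_vec[OF H(1)] by simp
    obtain g where g: "lead_coeff g = 1" "\<forall>b. fun_eval ((\<lambda>_. 0)(i := b)) H = poly g b"
      using H(2) unfolding monic_in_def by blast
    have "poly g b = poly 0 b" for b using g(2)[rule_format, of b] unfolding z by simp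
    then have "g = 0" by (rule poly_fun_eq_imp_eq)
    then show False using g(1) by simp
  qed
  then have top: "C r \<subset> carrier_vec n" using C(3) by (auto simp: zero_set_def)
  have irr: "irreducible_set n (C' j)" if "j \<le> Suc r" for j
    using C(1)[of j] by (simp add: C'_def irreducible_variety_iff irreducible_set_carrier_vec)
  have alg: "algebraic_set n (C' j)" if "j < Suc r" for j
    using C(1)[of j] that by (simp add: C'_def irreducible_variety_iff)
  have sub: "C' j \<subset> C' (Suc j)" if "j < Suc r" for j
    using C(2)[of j] top that by (cases "j = r") (simp_all add: C'_def)
  have "Suc r \<le> card {..<n}"
    by (rule chain_length_le[of "{..<n}" n id C' "Suc r", OF _ _ _ irr alg sub]) auto
  then show ?thesis by simp
qed

text \<open>The end of the chain through \<open>x\<close> is a component, because a larger variety in the hypersurface would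
  give a longer chain.\<close>

lemma local_dim_hypersurface:
  fixes H :: "'k::alg_closed_field mpoly"
  assumes H: "H \<in> mpolys n" "monic_in i d H" and i: "i < n" and x: "x \<in> zero_set n {H}"
  shows "local_dim n (zero_set n {H}) x = ereal (real (n - 1))"
proof -
  let ?V = "zero_set n {H}"
  have card: "card ({..<n} - {i}) = n - 1" using i by simp
  have x': "x \<in> carrier_vec n" "mpoly_eval H x = 0" using x by (auto simp: zero_set_def)
  have "finite ({..<n} - {i})" "{..<n} - {i} \<subseteq> {..<n} - {i}" by simp_all
  from chain_through_point[OF H i x' this, unfolded card]
  obtain C where C0: "x \<in> C 0" and C_sub: "C (n - 1) \<subseteq> {z\<in>carrier_vec n. mpoly_eval H z = 0 \<and>
      (\<forall>l<n. l \<notin> {..<n} - {i} \<longrightarrow> l \<noteq> i \<longrightarrow> z $ l = x $ l)}"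
    and C_irr: "\<forall>j\<le>n - 1. irreducible_variety n (C j)" and C_chain: "\<forall>j<n - 1. C j \<subset> C (Suc j)"
    by (elim exE conjE)
  have CV: "C (n - 1) \<subseteq> ?V"
  proof
    fix z assume "z \<in> C (n - 1)"
    with C_sub have "z \<in> carrier_vec n" "mpoly_eval H z = 0" by blast+
    then show "z \<in> ?V" by (simp add: zero_set_def)
  qed
  have sub: "C j \<subseteq> C (n - 1)" if "j \<le> n - 1" for j
    by (rule chain_mono[of "n - 1" C j]) (use C_chain that in blast)+
  have comp: "irreducible_component n ?V (C (n - 1))"
    unfolding irreducible_component_def
  proof (intro conjI allI impI)
    show "irreducible_variety n (C (n - 1))" "C (n - 1) \<subseteq> ?V" using C_irr CV by simp_all
    fix W assume W: "irreducible_variety n W" "C (n - 1) \<subseteq> W" "W \<subseteq> ?V"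
    show "W = C (n - 1)"
    proof (rule ccontr)
      assume ne: "W \<noteq> C (n - 1)"
      define D where "D j = (if j \<le> n - 1 then C j else W)" for j
      have "Suc (Suc (n - 1)) \<le> n"
      proof (rule chain_in_hypersurface[OF H, of _ D])
        show "irreducible_variety n (D j)" if "j \<le> Suc (n - 1)" for j using C_irr W(1) by (simp add: D_def)
        show "D j \<subset> D (Suc j)" if "j < Suc (n - 1)" for j
          using C_chain[rule_format, of j] W(2) ne that by (cases "j = n - 1") (simp_all add: D_def psubset_eq)
        show "D (Suc (n - 1)) \<subseteq> ?V" using W(3) by (simp add: D_def)
      qed
      then show False using i by simp
    qed
  qed
  have bound: "variety_dim n W \<le> ereal (real (n - 1))" if W: "W \<subseteq> ?V" for W
    unfolding variety_dim_def
  proof (rule SUP_least)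
    fix r assume "r \<in> {r. \<exists>C. (\<forall>i\<le>r. irreducible_variety n (C i) \<and> C i \<subseteq> W) \<and> (\<forall>i<r. C i \<subset> C (Suc i))}"
    then obtain D where D: "\<forall>i\<le>r. irreducible_variety n (D i) \<and> D i \<subseteq> W" "\<forall>i<r. D i \<subset> D (Suc i)" by blast
    then have "D r \<subseteq> ?V" using W by blast
    then have "Suc r \<le> n" using D by (intro chain_in_hypersurface[OF H, of r D]) auto
    then show "ereal (real r) \<le> ereal (real (n - 1))" by simp
  qed
  have "ereal (real (n - 1)) \<le> variety_dim n (C (n - 1))"
    unfolding variety_dim_def
  proof (rule SUP_upper, intro CollectI exI[of _ C] conjI)
    show "\<forall>j\<le>n - 1. irreducible_variety n (C j) \<and> C j \<subseteq> C (n - 1)" using C_irr sub by blast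
    show "\<forall>j<n - 1. C j \<subset> C (Suc j)" by (rule C_chain)
  qed
  also have "\<dots> \<le> local_dim n ?V x"
    unfolding local_dim_def by (rule SUP_upper) (use comp C0 sub[of 0] in blast)
  finally have "ereal (real (n - 1)) \<le> local_dim n ?V x" .
  moreover have "local_dim n ?V x \<le> ereal (real (n - 1))"
    unfolding local_dim_def
  proof (rule SUP_least)
    fix W assume "W \<in> {W. irreducible_component n ?V W \<and> x \<in> W}"
    then show "variety_dim n W \<le> ereal (real (n - 1))" by (intro bound) (simp add: irreducible_component_def)
  qed
  ultimately show ?thesis by (rule antisym[rotated])
qed

theorem singular_point_hypersurface:
  fixes H :: "'k::alg_closed_field mpoly"
  assumes "H \<in> mpolys n" "monic_in i d H" "i < n" "singular_point n (zero_set n {H}) x"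
  shows "mpoly_eval (mpoly_pderiv i H) x = 0"
proof (rule ccontr)
  assume smooth: "mpoly_eval (mpoly_pderiv i H) x \<noteq> 0"
  obtain Fs where x: "x \<in> zero_set n {H}" and Fs: "ideal_generated n Fs = vanishing_ideal n (zero_set n {H})"
    and ne: "ereal (real (kernel_dim (jacobian n Fs x))) \<noteq> local_dim n (zero_set n {H}) x"
    using assms(4) unfolding singular_point_def by blast
  show False
    using ne unfolding kernel_dim_jacobian_hypersurface[OF assms(1-3) x smooth Fs]
      local_dim_hypersurface[OF assms(1-3) x] by simp
qed



section \<open>The hypersurface associated to a polynomial\<close>

lemma monic_div_monic:
  fixes F N :: "'k::field poly"
  assumes F: "degree F = m + e" "lead_coeff F = 1" and N: "degree N = m" "lead_coeff N = 1" "m > 0"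
  shows "degree (F div N) = e" "lead_coeff (F div N) = 1"
proof -
  have N0: "N \<noteq> 0" using N(2) by auto
  let ?r = "F mod N"
  have r: "degree ?r < m" using degree_mod_less[OF N0, of F] N(1,3) by auto
  have eq: "N * (F div N) = F - ?r" by (simp add: minus_mod_eq_mult_div)
  have "coeff (F - ?r) (m + e) = 1" using F r by (simp add: coeff_eq_0)
  moreover have "degree (F - ?r) \<le> m + e" using F(1) r by (intro degree_diff_le) auto
  ultimately have d: "degree (F - ?r) = m + e"
    by (intro antisym le_degree) auto
  have q0: "F div N \<noteq> 0"
  proof
    assume "F div N = 0"
    then have "F - ?r = 0" using eq by simp
    with \<open>coeff (F - ?r) (m + e) = 1\<close> show False by simp
  qed
  show "degree (F div N) = e"
    using degree_mult_eq[OF N0 q0] unfolding eq d N(1) by simp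
  show "lead_coeff (F div N) = 1"
    using lead_coeff_mult[of N "F div N"] \<open>coeff (F - ?r) (m + e) = 1\<close> unfolding eq d N(2) by simp
qed

lemma degree_prod_linear: "degree (\<Prod>i\<in>I. [:- s i, 1:] :: 'k::field poly) = card I"
  by (subst degree_prod_eq_sum_degree) auto

lemma lead_coeff_prod_linear: "lead_coeff (\<Prod>i\<in>I. [:- s i, 1:] :: 'k::field poly) = 1"
  by (simp add: lead_coeff_prod)

text \<open>The specialisation of \<open>Q_poly k\<close> at the point with coordinates \<open>s\<close>.\<close>

definition node_poly :: "nat \<Rightarrow> (nat \<Rightarrow> 'k) \<Rightarrow> 'k::field poly" where
  "node_poly k s = (\<Prod>i<k+1. [:- s i, 1:])"

lemma node_poly_monic: "degree (node_poly k s) = k + 1" "lead_coeff (node_poly k s) = 1"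
proof -
  show "degree (node_poly k s) = k + 1" unfolding node_poly_def degree_prod_linear by simp
  show "lead_coeff (node_poly k s) = 1" unfolding node_poly_def by (rule lead_coeff_prod_linear)
qed

definition H_ac :: "nat \<Rightarrow> 'a::field poly \<Rightarrow> 'a alg_closure mpoly" where
  "H_ac k f = Poly_Mapping.map to_ac (H_poly k f)"

interpretation to_ac_hom: comm_ring_hom "to_ac :: 'a::field \<Rightarrow> 'a alg_closure"
  by unfold_locales auto

lemma map_poly_to_ac_monic:
  fixes f :: "'a::field poly"
  assumes "degree f = m" "lead_coeff f = 1"
  shows "degree (map_poly to_ac f) = m" "lead_coeff (map_poly to_ac f) = 1"
proof -
  show d: "degree (map_poly to_ac f) = m"
    using Polynomial.degree_map_poly[of to_ac f] assms(1) by simp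
  show "lead_coeff (map_poly to_ac f) = 1"
    unfolding d using assms by (simp add: coeff_map_poly)
qed

lemma R_poly_spec:
  fixes f :: "'a::field poly"
  shows "degree (R_poly k f) \<le> k" "Q_poly k dvd (map_poly mpoly_const f - R_poly k f)"
  using theI'[OF R_poly_ex1[of k f]] unfolding R_poly_def by blast+

lemma R_poly_unique:
  fixes f :: "'a::field poly"
  assumes "degree R \<le> k" "Q_poly k dvd (map_poly mpoly_const f - R)"
  shows "R = R_poly k f"
  using R_poly_ex1[of k f] R_poly_spec[of k f] assms by blast

lemma keys_map_to_ac: "Poly_Mapping.keys (Poly_Mapping.map to_ac p) = Poly_Mapping.keys p"
  by (auto simp: in_keys_iff map.rep_eq when_def)

lemma fun_eval_map_to_ac: "fun_eval s (Poly_Mapping.map to_ac p) = mpoly_subst to_ac s p"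
  unfolding mpoly_subst_def keys_map_to_ac
  by (rule sum.cong) (auto simp: map.rep_eq when_def in_keys_iff)

text \<open>Killing the variables from \<open>X\<^bsub>k+1\<^esub>\<close> on (counted from zero) fixes \<open>f\<close> and \<open>Q\<close>, hence by uniqueness also the
  remainder.\<close>

lemma H_ac_in_mpolys:
  fixes f :: "'a::field poly"
  shows "H_ac k f \<in> mpolys (k + 1)"
proof -
  let ?s = "\<lambda>l. if l < k + 1 then mpoly_var l else 0 :: 'a mpoly"
  define \<pi> where "\<pi> = mpoly_subst mpoly_const ?s"
  interpret \<pi>: comm_ring_hom \<pi> unfolding \<pi>_def by (rule mpoly_const_hom.mpoly_subst_hom)
  interpret m: map_poly_comm_ring_hom \<pi> ..
  have img: "\<pi> p \<in> mpolys (k + 1)" for p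
    unfolding \<pi>_def mpolys_eq by (rule mpolys_in_subst[of UNIV]) (auto simp: mpolys_in_def[of UNIV])
  have \<pi>_const: "\<pi> (mpoly_const a) = mpoly_const a" for a
    unfolding \<pi>_def by (rule mpoly_const_hom.mpoly_subst_const)
  have \<pi>_var: "\<pi> (mpoly_var l) = mpoly_var l" if "l < k + 1" for l
    unfolding \<pi>_def mpoly_const_hom.mpoly_subst_var using that by simp
  have Q: "map_poly \<pi> (Q_poly k) = Q_poly k"
    unfolding Q_poly_def m.hom_prod
    by (rule prod.cong) (auto simp: \<pi>.map_poly_pCons_hom \<pi>.hom_uminus \<pi>_var)
  have f: "map_poly \<pi> (map_poly mpoly_const f) = map_poly mpoly_const f"
    by (rule poly_eqI) (simp add: \<pi>_const)
  have "map_poly \<pi> (R_poly k f) = R_poly k f"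
  proof (rule R_poly_unique)
    show "degree (map_poly \<pi> (R_poly k f)) \<le> k"
      using degree_map_poly_le R_poly_spec(1) le_trans by blast
    have "map_poly \<pi> (Q_poly k) dvd map_poly \<pi> (map_poly mpoly_const f - R_poly k f)"
      using R_poly_spec(2) by (rule m.hom_dvd)
    then show "Q_poly k dvd map_poly mpoly_const f - map_poly \<pi> (R_poly k f)"
      by (simp add: Q f m.hom_minus)
  qed
  then have "\<pi> (H_poly k f) = H_poly k f"
    unfolding H_poly_def using \<pi>.coeff_map_poly_hom[of "R_poly k f" k] by simp
  with img[of "H_poly k f"] have "H_poly k f \<in> mpolys (k + 1)" by simp
  then show ?thesis by (simp add: H_ac_def mpolys_def keys_map_to_ac)
qed

text \<open>Specialisation commutes with division by the monic polynomial \<open>Q\<close>.\<close>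

lemma fun_eval_H_ac:
  fixes f :: "'a::field poly"
  shows "fun_eval s (H_ac k f) = coeff (map_poly to_ac f mod node_poly k s) k"
proof -
  define \<psi> where "\<psi> = (mpoly_subst to_ac s :: 'a mpoly \<Rightarrow> _)"
  interpret \<psi>: comm_ring_hom \<psi> unfolding \<psi>_def by (rule to_ac_hom.mpoly_subst_hom)
  interpret m: map_poly_comm_ring_hom \<psi> ..
  let ?R = "map_poly \<psi> (R_poly k f)"
  have \<psi>_const: "\<psi> (mpoly_const a) = to_ac a" for a
    unfolding \<psi>_def by (rule to_ac_hom.mpoly_subst_const)
  have \<psi>_var: "\<psi> (mpoly_var l) = s l" for l
    unfolding \<psi>_def by (rule to_ac_hom.mpoly_subst_var)
  have Q: "map_poly \<psi> (Q_poly k) = node_poly k s"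
    unfolding Q_poly_def node_poly_def m.hom_prod
    by (rule prod.cong) (auto simp: \<psi>.map_poly_pCons_hom \<psi>.hom_uminus \<psi>_var)
  have f: "map_poly \<psi> (map_poly mpoly_const f) = map_poly to_ac f"
    by (rule poly_eqI) (simp add: \<psi>_const)
  have "map_poly \<psi> (Q_poly k) dvd map_poly \<psi> (map_poly mpoly_const f - R_poly k f)"
    using R_poly_spec(2) by (rule m.hom_dvd)
  then have "node_poly k s dvd map_poly to_ac f - ?R" by (simp add: Q f m.hom_minus)
  then have "map_poly to_ac f mod node_poly k s = ?R mod node_poly k s" by (simp add: mod_eq_dvd_iff)
  moreover have "degree ?R < degree (node_poly k s)"
    using degree_map_poly_le[of \<psi> "R_poly k f"] R_poly_spec(1)[of k f] by (simp add: node_poly_monic)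
  then have "?R mod node_poly k s = ?R" by (rule mod_poly_less)
  ultimately have "coeff (map_poly to_ac f mod node_poly k s) k = \<psi> (H_poly k f)"
    by (simp add: H_poly_def)
  then show ?thesis unfolding H_ac_def fun_eval_map_to_ac \<psi>_def by simp
qed

text \<open>Division by all nodes is division by the nodes other than the \<open>i\<close>-th, followed by synthetic division of the
  quotient \<open>g\<close> at \<open>b\<close>; the remainder \<open>poly g b\<close> of the second step is what multiplies \<open>T\<^sup>k\<close>.\<close>

lemma divide_by_one_more_node:
  fixes F :: "'k::field poly" and s :: "nat \<Rightarrow> 'k"
  assumes k: "k > 0" and i: "i < k + 1"
  defines "g \<equiv> F div (\<Prod>l\<in>{..<k+1} - {i}. [:- s l, 1:])"
  shows "coeff (F mod node_poly k (s(i := b))) k = poly g b"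
    and "F div node_poly k (s(i := b)) = synthetic_div g b"
proof -
  let ?Q = "\<Prod>l\<in>{..<k+1} - {i}. [:- s l, 1:]"
  let ?N = "node_poly k (s(i := b))"
  have "degree ?Q = k" using i by (subst degree_prod_linear) simp
  moreover have "lead_coeff ?Q = 1" by (rule lead_coeff_prod_linear)
  ultimately have Q: "degree ?Q = k" "lead_coeff ?Q = 1" .
  have "(\<Prod>l\<in>{..<k+1} - {i}. [:- (s(i := b)) l, 1:]) = ?Q" by (rule prod.cong) auto
  then have N: "?N = [:- b, 1:] * ?Q"
    unfolding node_poly_def using i by (subst prod.remove[of _ i]) auto
  have Q0: "?Q \<noteq> 0" using Q(2) by auto
  let ?r = "F mod ?Q"
  let ?R = "smult (poly g b) ?Q + ?r"
  have r: "degree ?r < k" using degree_mod_less[OF Q0, of F] Q(1) k by auto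
  have g: "g = [:- b, 1:] * synthetic_div g b + [:poly g b:]"
    using synthetic_div_correct'[of b g] by simp
  have "F = ?Q * g + ?r" unfolding g_def by simp
  also have "\<dots> = ?N * synthetic_div g b + ?R"
    unfolding N by (subst g) (simp add: algebra_simps)
  finally have F: "F = ?N * synthetic_div g b + ?R" .
  have "degree ?R \<le> k" using r Q(1) by (intro degree_add_le) (auto intro: order_trans[OF degree_smult_le])
  then have deg: "degree ?R < degree ?N" by (simp add: node_poly_monic)
  have N0: "?N \<noteq> 0" using node_poly_monic(2)[of k "s(i := b)"] by auto
  have "F div ?N = (?N * synthetic_div g b + ?R) div ?N" by (rule arg_cong[OF F])
  also have "\<dots> = synthetic_div g b + ?R div ?N" by (rule div_mult_self4[OF N0])
  finally show "F div ?N = synthetic_div g b" unfolding div_poly_less[OF deg] by simp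
  have "F mod ?N = (?N * synthetic_div g b + ?R) mod ?N" by (rule arg_cong[OF F])
  also have "\<dots> = ?R" unfolding mod_mult_self4 by (rule mod_poly_less[OF deg])
  finally show "coeff (F mod ?N) k = poly g b" using Q r by (simp add: coeff_eq_0)
qed

lemma H_ac_monic_in:
  fixes f :: "'a::field poly"
  assumes k: "k > 0" and f: "degree f = k + d" "lead_coeff f = 1" and i: "i < k + 1"
  shows "monic_in i d (H_ac k f)"
  unfolding monic_in_def
proof
  fix s :: "nat \<Rightarrow> 'a alg_closure"
  let ?F = "map_poly to_ac f"
  let ?g = "?F div (\<Prod>l\<in>{..<k+1} - {i}. [:- s l, 1:])"
  have F: "degree ?F = k + d" "lead_coeff ?F = 1"
    using map_poly_to_ac_monic[OF f] by simp_all
  have "degree (\<Prod>l\<in>{..<k+1} - {i}. [:- s l, 1:]) = k" using i by (subst degree_prod_linear) simp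
  moreover have "lead_coeff (\<Prod>l\<in>{..<k+1} - {i}. [:- s l, 1:]) = 1" by (rule lead_coeff_prod_linear)
  ultimately have Q: "degree (\<Prod>l\<in>{..<k+1} - {i}. [:- s l, 1:]) = k"
    "lead_coeff (\<Prod>l\<in>{..<k+1} - {i}. [:- s l, 1:]) = 1" .
  have "lead_coeff ?g = 1 \<and> degree ?g = d" using monic_div_monic[OF F Q k] by blast
  moreover have "\<forall>b. fun_eval (s(i := b)) (H_ac k f) = poly ?g b"
    unfolding fun_eval_H_ac using divide_by_one_more_node(1)[OF k i] by blast
  ultimately show "\<exists>g. lead_coeff g = 1 \<and> degree g = d \<and> (\<forall>b. fun_eval (s(i := b)) (H_ac k f) = poly g b)"
    by blast
qed

text \<open>In the notation of the previous lemmas, \<open>g(b) = (b - s\<^sub>i) q(b) + g(s\<^sub>i)\<close> with \<open>q\<close> the quotient by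
  all nodes, so the derivative of \<open>g\<close> at \<open>s\<^sub>i\<close> is \<open>q(s\<^sub>i)\<close>.\<close>

lemma pderiv_H_ac:
  fixes f :: "'a::field poly"
  assumes k: "k > 0" and i: "i < k + 1"
  shows "fun_eval s (mpoly_pderiv i (H_ac k f)) = poly (map_poly to_ac f div node_poly k s) (s i)"
proof -
  let ?F = "map_poly to_ac f" and ?H = "H_ac k f"
  define g where "g = ?F div (\<Prod>l\<in>{..<k+1} - {i}. [:- s l, 1:])"
  define q where "q = synthetic_div g (s i)"
  have q: "?F div node_poly k s = q"
    using divide_by_one_more_node(2)[OF k i, of ?F s "s i"] by (simp add: q_def g_def)
  have g: "poly g b = (b - s i) * poly q b + poly g (s i)" for b
  proof -
    have "poly g b = poly ([:- s i, 1:] * q + [:poly g (s i):]) b"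
      unfolding q_def synthetic_div_correct' ..
    then show ?thesis by (simp add: algebra_simps)
  qed
  define \<gamma> where "\<gamma> m = (if m = i then [:s i, 1:] else [:s m:])" for m
  have "poly (curve_eval \<gamma> ?H) t = poly (pCons (poly g (s i)) (pcompose q [:s i, 1:])) t" for t
  proof -
    have hom: "comm_ring_hom (\<lambda>P :: 'a alg_closure poly. poly P t)" by unfold_locales auto
    have "poly (curve_eval \<gamma> ?H) t = mpoly_subst ((\<lambda>P. poly P t) \<circ> (\<lambda>a. [:a:])) ((\<lambda>P. poly P t) \<circ> \<gamma>) ?H"
      unfolding curve_eval_def by (rule hom_mpoly_subst[OF hom])
    also have "\<dots> = fun_eval (s(i := s i + t)) ?H"
      by (rule arg_cong2[of _ _ _ _ "\<lambda>h s. mpoly_subst h s ?H"]) (auto simp: \<gamma>_def fun_eq_iff)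
    also have "\<dots> = poly g (s i + t)"
      unfolding fun_eval_H_ac g_def by (rule divide_by_one_more_node(1)[OF k i])
    also have "\<dots> = poly (pCons (poly g (s i)) (pcompose q [:s i, 1:])) t"
      by (subst g) (simp add: poly_pcompose algebra_simps)
    finally show ?thesis .
  qed
  then have eq: "curve_eval \<gamma> ?H = pCons (poly g (s i)) (pcompose q [:s i, 1:])" by (rule poly_fun_eq_imp_eq)
  have "fun_eval s (mpoly_pderiv i ?H) = coeff (curve_eval \<gamma> ?H) 1"
    using coeff_1_curve_eval[of i "Suc i" \<gamma> s ?H] by (simp add: \<gamma>_def)
  also have "\<dots> = poly (pcompose q [:s i, 1:]) 0" unfolding eq by (simp add: poly_0_coeff_0)
  also have "\<dots> = poly q (s i)" by (simp add: poly_pcompose)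
  finally show ?thesis unfolding q .
qed

lemma singular_point_V_hyp:
  fixes f :: "'a::field poly"
  assumes k: "k > 0" and f: "degree f = k + d" "lead_coeff f = 1"
    and x: "x \<in> singular_locus (k + 1) (V_hyp k f)"
  defines "F \<equiv> map_poly to_ac f" and "N \<equiv> node_poly k (vec_index x)"
  shows "coeff (F mod N) k = 0" "\<And>i. i < k + 1 \<Longrightarrow> poly (F div N) (x $ i) = 0"
proof -
  have V: "V_hyp k f = zero_set (k + 1) {H_ac k f}" by (simp add: V_hyp_def H_ac_def)
  have sing: "singular_point (k + 1) (zero_set (k + 1) {H_ac k f}) x"
    using x unfolding singular_locus_def V by simp
  then have "mpoly_eval (H_ac k f) x = 0" by (simp add: singular_point_def zero_set_def)
  then show "coeff (F mod N) k = 0" unfolding mpoly_eval_eq fun_eval_H_ac F_def N_def .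
  fix i assume i: "i < k + 1"
  have "mpoly_eval (mpoly_pderiv i (H_ac k f)) x = 0"
    by (rule singular_point_hypersurface[OF H_ac_in_mpolys H_ac_monic_in[OF k f i] i sing])
  then show "poly (F div N) (x $ i) = 0" unfolding mpoly_eval_eq pderiv_H_ac[OF k i] F_def N_def .
qed

text \<open>The coordinates are roots of the quotient, which has degree \<open>d - 1\<close>.\<close>

lemma card_coordinates_singular_point:
  fixes f :: "'a::field poly"
  assumes k: "k > 0" and f: "degree f = k + d" "lead_coeff f = 1" "d > 0"
    and x: "x \<in> singular_locus (k + 1) (V_hyp k f)"
  shows "card (vec_index x ` {..<k+1}) \<le> d - 1"
proof -
  let ?q = "map_poly to_ac f div node_poly k (vec_index x)"
  have F: "degree (map_poly to_ac f :: 'a alg_closure poly) = (k + 1) + (d - 1)" "lead_coeff (map_poly to_ac f :: 'a alg_closure poly) = 1"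
    using map_poly_to_ac_monic[OF f(1,2)] f(3) by simp_all
  have q: "degree ?q = d - 1" "lead_coeff ?q = 1"
    using monic_div_monic[OF F node_poly_monic] by simp_all
  then have q0: "?q \<noteq> 0" by auto
  have "vec_index x ` {..<k+1} \<subseteq> {a. poly ?q a = 0}"
    using singular_point_V_hyp(2)[OF k f(1,2) x] by auto
  then have "card (vec_index x ` {..<k+1}) \<le> card {a. poly ?q a = 0}"
    using poly_roots_finite[OF q0] by (intro card_mono) auto
  also have "\<dots> \<le> d - 1" using card_poly_roots_bound[OF q0] q(1) by simp
  finally show ?thesis .
qed

lemma monic_eq_prod_roots:
  fixes q :: "'k::field poly"
  assumes "finite A" "degree q = card A" "lead_coeff q = 1" "\<And>a. a \<in> A \<Longrightarrow> poly q a = 0"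
  shows "q = (\<Prod>a\<in>A. [:- a, 1:])"
proof (rule ccontr)
  let ?p = "\<Prod>a\<in>A. [:- a, 1:]"
  assume "q \<noteq> ?p"
  then have nz: "q - ?p \<noteq> 0" by simp
  have p: "degree ?p = card A" "lead_coeff ?p = 1"
    by (rule degree_prod_linear, rule lead_coeff_prod_linear)
  have "coeff (q - ?p) (card A) = 0" using assms(2,3) p by simp
  moreover have "degree (q - ?p) \<le> card A" using assms(2) p(1) by (intro degree_diff_le) auto
  ultimately have "degree (q - ?p) < card A" using nz by (metis le_neq_implies_less leading_coeff_0_iff)
  moreover have "A \<subseteq> {a. poly (q - ?p) a = 0}"
    using assms(1,4) by (auto simp: poly_prod intro!: prod_zero)
  then have "card A \<le> card {a. poly (q - ?p) a = 0}"
    using poly_roots_finite[OF nz] by (rule card_mono[rotated])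
  moreover have "card {a. poly (q - ?p) a = 0} \<le> degree (q - ?p)" by (rule card_poly_roots_bound[OF nz])
  ultimately show False by simp
qed

text \<open>For \<open>t \<noteq> 0\<close> the roots \<open>t a\<close> exhaust those of the quotient, and the remainder has degree
  below \<open>k\<close>. So the coefficient of \<open>T\<^bsup>k+j\<^esup>\<close> in \<open>f\<close> is \<open>u(t)\<close> for a polynomial \<open>u\<close>; being constant for \<open>t \<noteq> 0\<close>, it is
  also \<open>u(0)\<close>, which is a coefficient of \<open>T\<^bsup>k+d\<^esup>\<close>.\<close>

lemma coeffs_zero_if_all_scalings_singular:
  fixes f :: "'a::field poly"
  assumes k: "k > 0" and f: "degree f = k + d" "lead_coeff f = 1" "d > 0"
    and card: "card (vec_index x ` {..<k+1}) = d - 1"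
    and sing: "\<And>t. vec (k + 1) (\<lambda>i. t * x $ i) \<in> singular_locus (k + 1) (V_hyp k f)"
    and j: "j < d"
  shows "coeff f (k + j) = 0"
proof -
  let ?F = "map_poly to_ac f"
  let ?A = "vec_index x ` {..<k+1}"
  define P :: "'a alg_closure poly poly" where
    "P = (\<Prod>i<k+1. [:[:0, - x $ i:], 1:]) * (\<Prod>a\<in>?A. [:[:0, - a:], 1:])"
  have P_eval: "map_poly (\<lambda>u. poly u t) P = (\<Prod>i<k+1. [:- (t * x $ i), 1:]) * (\<Prod>a\<in>?A. [:- (t * a), 1:])" for t
  proof -
    interpret m: map_poly_comm_ring_hom "\<lambda>u :: 'a alg_closure poly. poly u t" ..
    show ?thesis unfolding P_def m.hom_mult m.hom_prod
      by (intro arg_cong2[of _ _ _ _ "(*)"] prod.cong) (simp_all add: poly_hom.map_poly_pCons_hom)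
  qed
  define u where "u = coeff P (k + j)"
  have u_eval: "poly u t = coeff ((\<Prod>i<k+1. [:- (t * x $ i), 1:]) * (\<Prod>a\<in>?A. [:- (t * a), 1:])) (k + j)" for t
    unfolding P_eval[symmetric] u_def by (simp add: coeff_map_poly)
  have u: "poly u t = to_ac (coeff f (k + j))" if t: "t \<noteq> 0" for t
  proof -
    let ?y = "vec (k + 1) (\<lambda>i. t * x $ i)"
    let ?N = "node_poly k (vec_index ?y)"
    have N: "?N = (\<Prod>i<k+1. [:- (t * x $ i), 1:])" unfolding node_poly_def by (rule prod.cong) auto
    have F: "degree ?F = (k + 1) + (d - 1)" "lead_coeff ?F = 1"
      using map_poly_to_ac_monic[OF f(1,2)] f(3) by simp_all
    have inj: "inj_on ((*) t) ?A" using t by (auto simp: inj_on_def)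
    have q: "?F div ?N = (\<Prod>a\<in>(*) t ` ?A. [:- a, 1:])"
    proof (rule monic_eq_prod_roots)
      show "degree (?F div ?N) = card ((*) t ` ?A)"
        using monic_div_monic(1)[OF F node_poly_monic] card card_image[OF inj] by simp
      show "lead_coeff (?F div ?N) = 1" using monic_div_monic(2)[OF F node_poly_monic] by simp
      fix a assume "a \<in> (*) t ` ?A"
      then obtain i where "i < k + 1" "a = ?y $ i" by auto
      then show "poly (?F div ?N) a = 0" using singular_point_V_hyp(2)[OF k f(1,2) sing] by blast
    qed simp
    have "coeff (?F mod ?N) (k + j) = 0"
    proof (cases "j = 0")
      case True
      then show ?thesis using singular_point_V_hyp(1)[OF k f(1,2) sing] by simp
    next
      case False
      have "?N \<noteq> 0" using node_poly_monic(2)[of k "vec_index ?y"] by auto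
      then have "degree (?F mod ?N) \<le> k"
        using degree_mod_less[of ?N ?F] by (auto simp: node_poly_monic)
      then show ?thesis using False by (intro coeff_eq_0) simp
    qed
    then have "coeff ?F (k + j) = coeff (?N * (?F div ?N)) (k + j)"
      by (metis add.right_neutral coeff_add mult_div_mod_eq)
    also have "?F div ?N = (\<Prod>a\<in>?A. [:- (t * a), 1:])"
      using q unfolding prod.reindex[OF inj] by (simp only: o_def)
    also have "?N * (\<Prod>a\<in>?A. [:- (t * a), 1:]) = (\<Prod>i<k+1. [:- (t * x $ i), 1:]) * (\<Prod>a\<in>?A. [:- (t * a), 1:])"
      by (subst N) (rule refl)
    finally show ?thesis unfolding u_eval by (simp add: coeff_map_poly)
  qed
  have "infinite (UNIV - {0 :: 'a alg_closure})" using infinite_UNIV_alg_closed by simp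
  moreover have "UNIV - {0} \<subseteq> {t. poly (u - [:to_ac (coeff f (k + j)):]) t = 0}" using u by auto
  ultimately have "u - [:to_ac (coeff f (k + j)):] = 0"
    using poly_roots_finite[of "u - [:to_ac (coeff f (k + j)):]"] finite_subset by blast
  then have "to_ac (coeff f (k + j)) = poly u 0" by simp
  also have "poly u 0 = coeff (monom 1 (k + 1) * monom 1 (d - 1)) (k + j)"
    unfolding u_eval using card by (simp add: monom_altdef)
  also have "\<dots> = 0" using j by (simp add: mult_monom)
  finally show ?thesis by simp
qed

section \<open>Varieties whose points have few distinct coordinates\<close>

lemma irreducible_set_prod_nonvanishing:
  fixes p :: "'b \<Rightarrow> 'k::field mpoly"
  assumes W: "irreducible_set n W" and "finite I" "\<And>i. i \<in> I \<Longrightarrow> p i \<in> mpolys n"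
    "\<And>i. i \<in> I \<Longrightarrow> \<exists>x\<in>W. mpoly_eval (p i) x \<noteq> 0"
  shows "\<exists>x\<in>W. \<forall>i\<in>I. mpoly_eval (p i) x \<noteq> 0"
proof -
  have "\<exists>x\<in>W. mpoly_eval (\<Prod>i\<in>I. p i) x \<noteq> 0"
    using assms(2-4)
  proof (induction I rule: finite_induct)
    case empty
    then show ?case using W by (auto simp: irreducible_set_def)
  next
    case (insert i I)
    have "p i \<in> mpolys n" "(\<Prod>i\<in>I. p i) \<in> mpolys n"
      using insert.prems(1) by (auto simp: mpolys_eq)
    moreover have "\<exists>x\<in>W. mpoly_eval (p i) x \<noteq> 0" "\<exists>x\<in>W. mpoly_eval (\<Prod>i\<in>I. p i) x \<noteq> 0"
      using insert by blast+
    ultimately have "\<exists>x\<in>W. mpoly_eval (p i) x * mpoly_eval (\<Prod>i\<in>I. p i) x \<noteq> 0"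
      using W unfolding irreducible_set_def by blast
    then show ?case using insert.hyps by (simp add: mpoly_eval.hom_mult)
  qed
  then show ?thesis using assms(2) by (auto simp: mpoly_eval.hom_prod)
qed

text \<open>Such a linear space is parametrised by an affine space, over which polynomials form a domain.\<close>

lemma irreducible_set_identified_coordinates:
  assumes \<rho>: "\<And>i. i < n \<Longrightarrow> \<rho> i < n" "\<And>i. i < n \<Longrightarrow> \<rho> (\<rho> i) = \<rho> i"
  shows "irreducible_set n {x\<in>carrier_vec n. \<forall>i<n. x $ i = (x $ \<rho> i :: 'k::alg_closed_field)}" (is "irreducible_set n ?L")
  unfolding irreducible_set_def
proof (intro conjI ballI impI)
  have "0\<^sub>v n \<in> ?L" using \<rho>(1) by auto
  then show "?L \<noteq> {}" by blast
  fix p q :: "'k mpoly"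
  assume pq: "p \<in> mpolys n" "q \<in> mpolys n" "\<forall>x\<in>?L. mpoly_eval p x * mpoly_eval q x = 0"
  define c :: "'k mpoly \<Rightarrow> 'k mpoly" where "c = mpoly_subst mpoly_const (\<lambda>i. mpoly_var (\<rho> i))"
  have c: "fun_eval \<sigma> (c r) = fun_eval (\<sigma> \<circ> \<rho>) r" for \<sigma> r
  proof -
    have "fun_eval \<sigma> (c r) = mpoly_subst (fun_eval \<sigma> \<circ> mpoly_const) (fun_eval \<sigma> \<circ> (\<lambda>i. mpoly_var (\<rho> i))) r"
      unfolding c_def by (rule hom_mpoly_subst[OF fun_eval.comm_ring_hom_axioms])
    also have "\<dots> = fun_eval (\<sigma> \<circ> \<rho>) r"
      by (rule arg_cong2[of _ _ _ _ "\<lambda>h s. mpoly_subst h s r"]) (auto simp: fun_eq_iff)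
    finally show ?thesis .
  qed
  have "fun_eval \<sigma> (c p * c q) = 0" for \<sigma>
  proof -
    have "vec n (\<sigma> \<circ> \<rho>) \<in> ?L" using \<rho> by simp
    then have "mpoly_eval p (vec n (\<sigma> \<circ> \<rho>)) * mpoly_eval q (vec n (\<sigma> \<circ> \<rho>)) = 0" using pq(3) by blast
    then show ?thesis unfolding fun_eval.hom_mult c fun_eval_vec[OF pq(1)] fun_eval_vec[OF pq(2)] .
  qed
  then have "c p * c q = 0" by (rule mpoly_eq_0I[OF infinite_UNIV_alg_closed])
  then have or: "c p = 0 \<or> c q = 0" by simp
  have z: "mpoly_eval r x = 0" if r: "r \<in> mpolys n" "c r = 0" and x: "x \<in> ?L" for r x
  proof -
    have "mpoly_eval r x = fun_eval (vec_index x \<circ> \<rho>) r"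
      unfolding mpoly_eval_eq by (rule mpoly_subst_cong[OF r(1)[unfolded mpolys_eq]]) (use x in auto)
    also have "\<dots> = fun_eval (vec_index x) (c r)" by (rule c[symmetric])
    finally show ?thesis using r(2) by simp
  qed
  show "(\<forall>x\<in>?L. mpoly_eval p x = 0) \<or> (\<forall>x\<in>?L. mpoly_eval q x = 0)"
    using or z[OF pq(1)] z[OF pq(2)] by blast
qed auto

text \<open>Let \<open>\<rho>\<close> send each index to the least one whose coordinate agrees with it on all of \<open>C r\<close>. A general
  point of \<open>C r\<close> has as many distinct coordinates as \<open>\<rho>\<close> has values, which is at most \<open>r\<close> by
  assumption and at least \<open>r\<close> by the length of the chain. So \<open>C r\<close> is the whole linear space
  \<open>x\<^sub>i = x\<^bsub>\<rho> i\<^esub>\<close>: otherwise that space would lengthen the chain. Linear spaces are closed under scaling.\<close>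

lemma variety_of_few_distinct_coordinates:
  fixes C :: "nat \<Rightarrow> 'k::alg_closed_field vec set"
  assumes chain: "\<And>j. j \<le> r \<Longrightarrow> irreducible_variety n (C j)" "\<And>j. j < r \<Longrightarrow> C j \<subset> C (Suc j)"
    and few: "\<And>x. x \<in> C r \<Longrightarrow> card (vec_index x ` {..<n}) \<le> r"
  shows "\<exists>x\<in>C r. card (vec_index x ` {..<n}) = r \<and> (\<forall>t. vec n (\<lambda>i. t * x $ i) \<in> C r)"
proof -
  let ?W = "C r"
  have W: "algebraic_set n ?W" "irreducible_set n ?W"
    using chain(1)[of r] by (auto simp: irreducible_variety_iff)
  define E where "E i j \<longleftrightarrow> (\<forall>x\<in>?W. x $ i = x $ j)" for i j
  define \<rho> where "\<rho> i = (LEAST j. E i j)" for i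
  have Erefl: "E i i" for i by (simp add: E_def)
  have E\<rho>: "E i (\<rho> i)" for i unfolding \<rho>_def by (rule LeastI[of _ i]) (rule Erefl)
  have \<rho>_le: "\<rho> i \<le> i" for i unfolding \<rho>_def by (rule Least_le) (rule Erefl)
  have \<rho>_cong: "\<rho> i = \<rho> j" if "E i j" for i j
  proof -
    have "E i = E j" using that by (auto simp: E_def fun_eq_iff)
    then show ?thesis by (simp add: \<rho>_def)
  qed
  have \<rho>_idem: "\<rho> (\<rho> i) = \<rho> i" for i using \<rho>_cong[OF E\<rho>] by simp
  have \<rho>_less: "\<rho> i < n" if "i < n" for i using \<rho>_le[of i] that by simp
  define R where "R = \<rho> ` {..<n}"
  have R: "finite R" "R \<subseteq> {..<n}" "\<And>i. i < n \<Longrightarrow> \<rho> i \<in> R" using \<rho>_less by (auto simp: R_def)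
  have alg: "algebraic_set n (C j)" and irr: "irreducible_set n (C j)" if "j \<le> r" for j
    using chain(1)[OF that] by (auto simp: irreducible_variety_iff)
  have r_le: "r \<le> card R"
  proof (rule chain_length_le[of R n \<rho> C r, OF R(2,3)])
    show "x $ i = x $ \<rho> i" if "x \<in> C r" for x i using E\<rho>[of i] that by (simp add: E_def)
  qed (use irr alg chain(2) in simp_all)
  let ?I = "{(i, j). i \<in> R \<and> j \<in> R \<and> i \<noteq> j}"
  have "\<exists>x\<in>?W. \<forall>ij\<in>?I. mpoly_eval (mpoly_var (fst ij) - mpoly_var (snd ij)) x \<noteq> 0"
  proof (rule irreducible_set_prod_nonvanishing[OF W(2)])
    have "?I \<subseteq> R \<times> R" by auto
    then show "finite ?I" using R(1) finite_subset by blast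
    fix ij assume ij: "ij \<in> ?I"
    then have "fst ij < n" "snd ij < n" using R(2) by auto
    then show "mpoly_var (fst ij) - mpoly_var (snd ij) \<in> mpolys n" by (auto simp: mpolys_eq)
    obtain a b where ab: "fst ij = \<rho> a" "snd ij = \<rho> b" "\<rho> a \<noteq> \<rho> b" using ij by (auto simp: R_def)
    \<comment> \<open>representatives of different classes differ somewhere on \<open>C r\<close>\<close>
    have "\<not> E (\<rho> a) (\<rho> b)" using \<rho>_cong[of "\<rho> a" "\<rho> b"] ab(3) \<rho>_idem by auto
    then show "\<exists>x\<in>?W. mpoly_eval (mpoly_var (fst ij) - mpoly_var (snd ij)) x \<noteq> 0"
      unfolding E_def by (simp add: ab(1,2) mpoly_eval.hom_minus)
  qed
  then obtain x where x: "x \<in> ?W" "\<forall>ij\<in>?I. mpoly_eval (mpoly_var (fst ij) - mpoly_var (snd ij)) x \<noteq> 0" by blast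
  have "inj_on (vec_index x) R"
  proof (rule inj_onI, rule ccontr)
    fix i j assume "i \<in> R" "j \<in> R" "x $ i = x $ j" "i \<noteq> j"
    then show False using x(2)[rule_format, of "(i, j)"] by (simp add: mpoly_eval.hom_minus)
  qed
  then have "card R = card (vec_index x ` R)" by (simp add: card_image)
  also have "\<dots> \<le> card (vec_index x ` {..<n})" using R(2) by (intro card_mono image_mono) auto
  finally have "card R \<le> card (vec_index x ` {..<n})" .
  with few[OF x(1)] r_le have eq: "card R = r" "card (vec_index x ` {..<n}) = r" by simp_all
  let ?L = "{x\<in>carrier_vec n. \<forall>i<n. x $ i = (x $ \<rho> i :: 'k)}"
  have WL: "?W \<subseteq> ?L"
    using E\<rho> algebraic_set_carrier[OF W(1)] by (auto simp: E_def)
  have "?L \<subseteq> ?W"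
  proof (rule ccontr)
    assume "\<not> ?L \<subseteq> ?W"
    then have strict: "?W \<subset> ?L" using WL by blast
    define D where "D j = (if j \<le> r then C j else ?L)" for j
    have irrL: "irreducible_set n ?L"
      by (rule irreducible_set_identified_coordinates[OF \<rho>_less \<rho>_idem])
    have "Suc r \<le> card R"
    proof (rule chain_length_le[of R n \<rho> D "Suc r", OF R(2,3)])
      show "y $ i = y $ \<rho> i" if "y \<in> D (Suc r)" "i < n" for y i using that by (simp add: D_def)
      show "irreducible_set n (D j)" for j
        using irr[of j] irrL by (simp add: D_def)
      show "algebraic_set n (D j)" if "j < Suc r" for j using alg[of j] that by (simp add: D_def)
      show "D j \<subset> D (Suc j)" if "j < Suc r" for j
        using chain(2)[of j] strict that by (cases "j = r") (simp_all add: D_def)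
    qed
    then show False using eq(1) by simp
  qed
  moreover have "vec n (\<lambda>i. t * x $ i) \<in> ?L" for t
    using WL x(1) \<rho>_less by auto
  ultimately show ?thesis using x(1) eq(2) by blast
qed

section \<open>Singular loci of dimension d - 1\<close>

theorem theorem4p2:
  fixes f :: "'a::finite_field poly" and c :: "nat \<Rightarrow> 'a" and d k :: nat
  assumes "0 < d" and "d < k"
    and "f = monom 1 (k + d) + (\<Sum>i<d. monom (c i) (k + i))"
    and "variety_dim (k + 1) (singular_locus (k + 1) (V_hyp k f)) = ereal (real d - 1)"
  shows "\<forall>i<d. c i = 0"
proof -
  let ?S = "singular_locus (k + 1) (V_hyp k f)"
  have k: "k > 0" using assms(2) by simp
  have coeff_f: "coeff f e = (if e = k + d then 1 else if k \<le> e \<and> e < k + d then c (e - k) else 0)" for e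
  proof -
    have "(\<Sum>i<d. coeff (monom (c i) (k + i)) e) = (\<Sum>i<d. if i = e - k \<and> k \<le> e then c i else 0)"
      by (rule sum.cong) auto
    also have "\<dots> = (if k \<le> e \<and> e < k + d then c (e - k) else 0)"
      by (cases "k \<le> e") (auto simp: sum.delta)
    finally show ?thesis unfolding assms(3) by (simp add: coeff_sum)
  qed
  have f: "degree f = k + d"
  proof (rule antisym)
    show "degree f \<le> k + d" by (rule degree_le) (auto simp: coeff_f)
    show "k + d \<le> degree f" by (rule le_degree) (simp add: coeff_f)
  qed
  then have lc: "lead_coeff f = 1" by (simp add: coeff_f)
  have "\<exists>r C. d - 1 \<le> r \<and> (\<forall>i\<le>r. irreducible_variety (k + 1) (C i) \<and> C i \<subseteq> ?S) \<and> (\<forall>i<r. C i \<subset> C (Suc i))"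
  proof (rule ccontr)
    assume none: "\<not> ?thesis"
    \<comment> \<open>this includes the case of an empty singular locus, of dimension \<open>- \<infinity>\<close>\<close>
    have "variety_dim (k + 1) ?S \<le> ereal (real d - 2)"
      unfolding variety_dim_def
    proof (rule SUP_least)
      fix r assume "r \<in> {r. \<exists>C. (\<forall>i\<le>r. irreducible_variety (k + 1) (C i) \<and> C i \<subseteq> ?S) \<and> (\<forall>i<r. C i \<subset> C (Suc i))}"
      then have "\<not> d - 1 \<le> r" using none by blast
      then have "r + 2 \<le> d" by simp
      then have "real r \<le> real d - 2" using of_nat_mono[of "r + 2" d, where ?'a = real] by simp
      then show "ereal (real r) \<le> ereal (real d - 2)" by simp
    qed
    then show False using assms(4) by simp
  qed
  then obtain r C where r: "d - 1 \<le> r"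
    and C: "\<forall>i\<le>r. irreducible_variety (k + 1) (C i) \<and> C i \<subseteq> ?S" "\<forall>i<r. C i \<subset> C (Suc i)"
    by blast
  have few: "card (vec_index x ` {..<k+1}) \<le> d - 1" if "x \<in> C r" for x
    using card_coordinates_singular_point[OF k f lc assms(1)] C(1) that by blast
  have "\<exists>x\<in>C r. card (vec_index x ` {..<k+1}) = r \<and> (\<forall>t. vec (k + 1) (\<lambda>i. t * x $ i) \<in> C r)"
  proof (rule variety_of_few_distinct_coordinates)
    show "irreducible_variety (k + 1) (C i)" if "i \<le> r" for i using C(1) that by blast
    show "C i \<subset> C (Suc i)" if "i < r" for i using C(2) that by blast
    show "card (vec_index y ` {..<k+1}) \<le> r" if "y \<in> C r" for y using few[OF that] r by simp
  qed
  then obtain x where x: "x \<in> C r" "card (vec_index x ` {..<k+1}) = r" "\<forall>t. vec (k + 1) (\<lambda>i. t * x $ i) \<in> C r"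
    by blast
  have card: "card (vec_index x ` {..<k+1}) = d - 1" using few[OF x(1)] x(2) r by simp
  have sing: "vec (k + 1) (\<lambda>i. t * x $ i) \<in> ?S" for t using x(3) C(1) by blast
  show ?thesis
  proof (intro allI impI)
    fix j assume j: "j < d"
    show "c j = 0"
      using coeffs_zero_if_all_scalings_singular[OF k f lc assms(1) card sing j] j
      by (simp add: coeff_f)
  qed
qed

end
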